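(* Let $\mathbf p\in\mathbb Z^2\setminus\{0\}$, $\Gamma\in\mathbb C\setminus\{0\}$, and let $L$ be the associated linearized 2D Euler operator on $\ell^2(\mathbb Z^2)$. Then the strongly continuous group $\{e^{tL}\}$ generated by $L$ satisfies $$\sigma(e^{tL})=e^{t\sigma(L)}\quad\text{for all } t\in\mathbb R,\ t\neq0.$$
   Context: Notation: $\|\cdot\|$ is the Euclidean norm on $\mathbb R^2$; $\sigma(\cdot)$ is the spectrum; $e^{t\sigma(L)}=\{e^{t\lambda}:\lambda\in\sigma(L)\}$. For $\mathbf a=(a_1,a_2),\mathbf b=(b_1,b_2)\in\mathbb Z^2$ set $$A(\mathbf a,\mathbf b)=\frac12\left[\frac1{\|\mathbf a\|^2}-\frac1{\|\mathbf b\|^2}\right](a_1b_2-a_2b_1)\quad\text{if }\mathbf a\ne\pm\mathbf b,\ \mathbf a\neq0,\ \mathbf b\ne0,$$ and $A(\mathbf a,\mathbf b)=0$ otherwise. The linearized 2D Euler operator (linearization, in Fourier variables, of the vorticity equation about the steady state whose only nonzero Fourier modes are $\omega^0_{\mathbf p}=\frac12\Gamma$, $\omega^0_{-\mathbf p}=\frac12\overline\Gamma$) is the operator on the space $\ell^2(\mathbb Z^2)$ of complex sequences $$L:(\omega_{\mathbf k})_{\mathbf k\in\mathbb Z^2}\mapsto\bigl(A(\mathbf p,\mathbf k-\mathbf p)\Gamma\omega_{\mathbf k-\mathbf p}+A(-\mathbf p,\mathbf k+\mathbf p)\overline\Gamma\omega_{\mathbf k+\mathbf p}\bigr)_{\mathbf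 k\in\mathbb Z^2},$$ with domain the set of all $\omega\in\ell^2(\mathbb Z^2)$ such that $L\omega\in\ell^2(\mathbb Z^2)$. This $L$ is the sum of a skew-adjoint operator and a compact operator, hence generates a strongly continuous group $\{e^{tL}\}_{t\in\mathbb R}$ on $\ell^2(\mathbb Z^2)$. *)

theory Defs
  imports "HOL-Analysis.Analysis"
begin

section \<open>Square-summable complex families\<close>

definition square_summable :: "('a \<Rightarrow> complex) \<Rightarrow> bool" where
  "square_summable f \<longleftrightarrow> (\<lambda>k. (cmod (f k))\<^sup>2) summable_on UNIV"

typedef 'a ell2 = "{f :: 'a \<Rightarrow> complex. square_summable f}"
  morphisms coord Abs_ell2
  by (rule exI[of _ "\<lambda>_. 0"]) (simp add: square_summable_def)

setup_lifting type_definition_ell2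

lemma square_summable_coord: "square_summable (coord x)"
  using coord[of x] by simp

lemma ell2_eqI: "(\<And>k. coord x k = coord y k) \<Longrightarrow> x = y"
  by (simp add: coord_inject[symmetric] ext)

lemma square_summable_iff_bound:
  "square_summable f \<longleftrightarrow> (\<exists>B. \<forall>F. finite F \<longrightarrow> L2_set (\<lambda>k. cmod (f k)) F \<le> B)"
proof
  assume s: "square_summable f"
  have "L2_set (\<lambda>k. cmod (f k)) F \<le> sqrt (\<Sum>\<^sub>\<infinity>k. (cmod (f k))\<^sup>2)" if "finite F" for F
    unfolding L2_set_def
    by (rule real_sqrt_le_mono, rule finite_sum_le_infsum)
      (use s that in \<open>auto simp: square_summable_def\<close>)
  then show "\<exists>B. \<forall>F. finite F \<longrightarrow> L2_set (\<lambda>k. cmod (f k)) F \<le> B" by blast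
next
  assume "\<exists>B. \<forall>F. finite F \<longrightarrow> L2_set (\<lambda>k. cmod (f k)) F \<le> B"
  then obtain B where B: "\<And>F. finite F \<Longrightarrow> L2_set (\<lambda>k. cmod (f k)) F \<le> B" by blast
  have "(\<Sum>k\<in>F. (cmod (f k))\<^sup>2) \<le> B\<^sup>2" if "finite F" for F
  proof -
    have "(L2_set (\<lambda>k. cmod (f k)) F)\<^sup>2 \<le> B\<^sup>2"
      by (rule power_mono[OF B[OF that] L2_set_nonneg])
    then show ?thesis by (simp add: L2_set_def sum_nonneg)
  qed
  then have "bdd_above (sum (\<lambda>k. (cmod (f k))\<^sup>2) ` {F. F \<subseteq> UNIV \<and> finite F})"
    by (intro bdd_aboveI[of _ "B\<^sup>2"]) auto
  then show "square_summable f"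
    unfolding square_summable_def by (intro nonneg_bdd_above_summable_on) auto
qed

lemma square_summable_scale:
  assumes "square_summable f" shows "square_summable (\<lambda>k. c * f k)"
  using summable_on_cmult_right[of "\<lambda>k. (cmod (f k))\<^sup>2" UNIV "(cmod c)\<^sup>2"] assms
  by (simp add: square_summable_def norm_mult power_mult_distrib)

lemma L2_set_cmod_add_le:
  "L2_set (\<lambda>k. cmod (f k + g k)) F \<le> L2_set (\<lambda>k. cmod (f k)) F + L2_set (\<lambda>k. cmod (g k)) F"
proof -
  have "L2_set (\<lambda>k. cmod (f k + g k)) F \<le> L2_set (\<lambda>k. cmod (f k) + cmod (g k)) F"
    by (rule L2_set_mono) (auto intro: norm_triangle_ineq)
  also have "\<dots> \<le> L2_set (\<lambda>k. cmod (f k)) F + L2_set (\<lambda>k. cmod (g k)) F"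
    by (rule L2_set_triangle_ineq)
  finally show ?thesis .
qed

lemma square_summable_add:
  assumes "square_summable f" "square_summable g"
  shows "square_summable (\<lambda>k. f k + g k)"
proof -
  obtain B C where "\<And>F. finite F \<Longrightarrow> L2_set (\<lambda>k. cmod (f k)) F \<le> B"
    and "\<And>F. finite F \<Longrightarrow> L2_set (\<lambda>k. cmod (g k)) F \<le> C"
    using assms unfolding square_summable_iff_bound by blast
  then have "L2_set (\<lambda>k. cmod (f k + g k)) F \<le> B + C" if "finite F" for F
    using L2_set_cmod_add_le[of f g F] that by (meson add_mono order_trans)
  then show ?thesis unfolding square_summable_iff_bound by blast
qed

instantiation ell2 :: (type) real_normed_vector
begin

lift_definition zero_ell2 :: "'a ell2" is "\<lambda>_. 0"
  by (simp add: square_summable_def)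

lift_definition plus_ell2 :: "'a ell2 \<Rightarrow> 'a ell2 \<Rightarrow> 'a ell2" is "\<lambda>f g k. f k + g k"
  by (rule square_summable_add)

lift_definition uminus_ell2 :: "'a ell2 \<Rightarrow> 'a ell2" is "\<lambda>f k. - f k"
  by (simp add: square_summable_def)

lift_definition minus_ell2 :: "'a ell2 \<Rightarrow> 'a ell2 \<Rightarrow> 'a ell2" is "\<lambda>f g k. f k - g k"
proof -
  fix f g :: "'a \<Rightarrow> complex"
  assume "square_summable f" "square_summable g"
  then show "square_summable (\<lambda>k. f k - g k)"
    using square_summable_add[of f "\<lambda>k. - g k"] by (simp add: square_summable_def)
qed

lift_definition scaleR_ell2 :: "real \<Rightarrow> 'a ell2 \<Rightarrow> 'a ell2" is "\<lambda>r f k. of_real r * f k"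
  by (rule square_summable_scale)

definition norm_ell2 :: "'a ell2 \<Rightarrow> real" where
  "norm_ell2 x = sqrt (\<Sum>\<^sub>\<infinity>k. (cmod (coord x k))\<^sup>2)"

definition sgn_ell2 :: "'a ell2 \<Rightarrow> 'a ell2" where
  "sgn_ell2 x = inverse (norm x) *\<^sub>R x"

definition dist_ell2 :: "'a ell2 \<Rightarrow> 'a ell2 \<Rightarrow> real" where
  "dist_ell2 x y = norm (x - y)"

definition uniformity_ell2 :: "('a ell2 \<times> 'a ell2) filter" where
  "uniformity_ell2 = (INF e\<in>{0<..}. principal {(x, y). dist x y < e})"

definition open_ell2 :: "'a ell2 set \<Rightarrow> bool" where
  "open_ell2 U \<longleftrightarrow> (\<forall>x\<in>U. \<forall>\<^sub>F (x', y) in uniformity. x' = x \<longrightarrow> y \<in> U)"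

instance
proof
  fix x y z :: "'a ell2" and a b r :: real and U :: "'a ell2 set"
  have L2_le: "L2_set (\<lambda>k. cmod (coord w k)) F \<le> norm w" if "finite F" for w :: "'a ell2" and F
    unfolding L2_set_def norm_ell2_def
    by (rule real_sqrt_le_mono, rule finite_sum_le_infsum)
      (use square_summable_coord[of w] that in \<open>auto simp: square_summable_def\<close>)
  show "x + y + z = x + (y + z)" by transfer (simp add: add.assoc)
  show "x + y = y + x" by transfer (simp add: add.commute)
  show "0 + x = x" by transfer simp
  show "- x + x = 0" by transfer simp
  show "x - y = x + - y" by transfer simp
  show "a *\<^sub>R (x + y) = a *\<^sub>R x + a *\<^sub>R y" by transfer (simp add: algebra_simps)
  show "(a + b) *\<^sub>R x = a *\<^sub>R x + b *\<^sub>R x" by transfer (simp add: algebra_simps)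
  show "a *\<^sub>R b *\<^sub>R x = (a * b) *\<^sub>R x" by transfer (simp add: algebra_simps)
  show "1 *\<^sub>R x = x" by transfer simp
  show "sgn x = inverse (norm x) *\<^sub>R x" by (rule sgn_ell2_def)
  show "dist x y = norm (x - y)" by (rule dist_ell2_def)
  show "uniformity = (INF e\<in>{0<..}. principal {(x, y). dist (x::'a ell2) y < e})"
    by (rule uniformity_ell2_def)
  show "open U \<longleftrightarrow> (\<forall>x\<in>U. \<forall>\<^sub>F (x', y) in uniformity. x' = x \<longrightarrow> y \<in> U)"
    by (rule open_ell2_def)
  show "norm x = 0 \<longleftrightarrow> x = 0"
  proof
    assume n: "norm x = 0"
    have "coord x k = 0" for k
      using L2_le[of "{k}" x] n by simp
    then show "x = 0" by (intro ell2_eqI) (simp add: zero_ell2.rep_eq)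
  qed (simp add: norm_ell2_def zero_ell2.rep_eq)
  show "norm (x + y) \<le> norm x + norm y"
  proof -
    have le: "L2_set (\<lambda>k. cmod (coord (x + y) k)) F \<le> norm x + norm y" if "finite F" for F
      using L2_set_cmod_add_le[of "coord x" "coord y" F] L2_le[OF that, of x] L2_le[OF that, of y]
      by (simp add: plus_ell2.rep_eq)
    have nn: "0 \<le> norm x + norm y"
      using le[of "{}"] by simp
    have "(\<Sum>\<^sub>\<infinity>k. (cmod (coord (x + y) k))\<^sup>2) \<le> (norm x + norm y)\<^sup>2"
    proof (rule infsum_le_finite_sums)
      show "(\<lambda>k. (cmod (coord (x + y) k))\<^sup>2) summable_on UNIV"
        using square_summable_coord[of "x + y"] by (simp add: square_summable_def)
      fix F :: "'a set" assume "finite F"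
      then have "(L2_set (\<lambda>k. cmod (coord (x + y) k)) F)\<^sup>2 \<le> (norm x + norm y)\<^sup>2"
        by (intro power_mono le L2_set_nonneg)
      then show "(\<Sum>k\<in>F. (cmod (coord (x + y) k))\<^sup>2) \<le> (norm x + norm y)\<^sup>2"
        by (simp add: L2_set_def sum_nonneg)
    qed
    then show ?thesis
      using nn by (simp add: norm_ell2_def[of "x + y"] real_le_lsqrt)
  qed
  show "norm (a *\<^sub>R x) = \<bar>a\<bar> * norm x"
    by (simp add: norm_ell2_def scaleR_ell2.rep_eq norm_mult power_mult_distrib
        infsum_cmult_right' real_sqrt_mult)
qed

end

lift_definition scaleC :: "complex \<Rightarrow> 'a ell2 \<Rightarrow> 'a ell2" (infixr \<open>*\<^sub>C\<close> 75)
  is "\<lambda>c f k. c * f k"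
  by (rule square_summable_scale)

section \<open>Spectrum and strongly continuous groups\<close>

definition bounded_clinear :: "('a ell2 \<Rightarrow> 'a ell2) \<Rightarrow> bool" where
  "bounded_clinear S \<longleftrightarrow> bounded_linear S \<and> (\<forall>c x. S (c *\<^sub>C x) = c *\<^sub>C S x)"

text \<open>
  A possibly unbounded operator is given by its domain \<open>D\<close> and a total function \<open>A\<close>
  whose values outside \<open>D\<close> are irrelevant; a bounded operator has domain \<^term>\<open>UNIV\<close>.
\<close>

definition resolvent_set :: "'a ell2 set \<Rightarrow> ('a ell2 \<Rightarrow> 'a ell2) \<Rightarrow> complex set" where
  "resolvent_set D A = {z. \<exists>R. bounded_clinear R \<and>
     (\<forall>y. R y \<in> D \<and> z *\<^sub>C R y - A (R y) = y) \<and>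
     (\<forall>x\<in>D. R (z *\<^sub>C x - A x) = x)}"

definition spectrum :: "'a ell2 set \<Rightarrow> ('a ell2 \<Rightarrow> 'a ell2) \<Rightarrow> complex set" where
  "spectrum D A = - resolvent_set D A"

definition strongly_continuous_group :: "(real \<Rightarrow> 'a ell2 \<Rightarrow> 'a ell2) \<Rightarrow> bool" where
  "strongly_continuous_group T \<longleftrightarrow>
     (\<forall>t. bounded_clinear (T t)) \<and>
     T 0 = id \<and>
     (\<forall>s t. T (s + t) = T s \<circ> T t) \<and>
     (\<forall>x. continuous_on UNIV (\<lambda>t. T t x))"

text \<open>
  The equivalence below says that the operator with domain \<open>D\<close> equals the infinitesimal
  generator, domains included: \<open>x\<close> lies in \<open>D\<close> exactly when the orbit of \<open>x\<close> is
  differentiable at 0, and then \<open>A x\<close> is the derivative.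
\<close>

definition generates_group ::
    "'a ell2 set \<Rightarrow> ('a ell2 \<Rightarrow> 'a ell2) \<Rightarrow> (real \<Rightarrow> 'a ell2 \<Rightarrow> 'a ell2) \<Rightarrow> bool" where
  "generates_group D A T \<longleftrightarrow> strongly_continuous_group T \<and>
     (\<forall>x y. x \<in> D \<and> A x = y \<longleftrightarrow> ((\<lambda>t. T t x) has_vector_derivative y) (at 0))"

section \<open>The linearized 2D Euler operator\<close>

definition enorm :: "int \<times> int \<Rightarrow> real" where
  "enorm a = norm (real_of_int (fst a), real_of_int (snd a))"

definition euler_coeff :: "int \<times> int \<Rightarrow> int \<times> int \<Rightarrow> real" where
  "euler_coeff a b =
     (if a \<noteq> b \<and> a \<noteq> - b \<and> a \<noteq> 0 \<and> b \<noteq> 0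
      then 1 / 2 * (1 / (enorm a)\<^sup>2 - 1 / (enorm b)\<^sup>2)
             * real_of_int (fst a * snd b - snd a * fst b)
      else 0)"

definition euler_seq ::
    "int \<times> int \<Rightarrow> complex \<Rightarrow> (int \<times> int \<Rightarrow> complex) \<Rightarrow> int \<times> int \<Rightarrow> complex" where
  "euler_seq p \<Gamma> w k =
     of_real (euler_coeff p (k - p)) * \<Gamma> * w (k - p)
     + of_real (euler_coeff (- p) (k + p)) * cnj \<Gamma> * w (k + p)"

definition euler_dom :: "int \<times> int \<Rightarrow> complex \<Rightarrow> (int \<times> int) ell2 set" where
  "euler_dom p \<Gamma> = {w. square_summable (euler_seq p \<Gamma> (coord w))}"

definition euler_op :: "int \<times> int \<Rightarrow> complex \<Rightarrow> (int \<times> int) ell2 \<Rightarrow> (int \<times> int) ell2" where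
  "euler_op p \<Gamma> w = Abs_ell2 (euler_seq p \<Gamma> (coord w))"

end

theory Submission
  imports Defs
begin

text \<open>
  The shifts by \<open>\<plusminus>p\<close> preserve the integer \<open>p \<times> k\<close>, so the strips \<open>\<bar>p \<times> k\<bar> \<le> \<parallel>p\<parallel>\<^sup>2 + n\<close>
  are invariant under \<open>L\<close>, exhaust the lattice, and carry bounded pieces \<open>A n\<close> of \<open>L\<close>. Off the
  innermost strip every lattice point satisfies \<open>\<parallel>k\<parallel>\<^sup>2 \<ge> \<parallel>p\<parallel>\<^sup>2 + 1\<close>; there the weighted energy
  \<open>\<Sum> (1/\<parallel>p\<parallel>\<^sup>2 - 1/\<parallel>k\<parallel>\<^sup>2) \<bar>\<omega>\<^sub>k\<bar>\<^sup>2\<close> is equivalent to the norm and conserved, so the groups generated by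
  the \<open>A n\<close> are bounded there uniformly in \<open>n\<close> and \<open>t\<close>. They therefore glue to the group of \<open>L\<close>, and a
  spectral value \<open>\<mu>\<close> of \<open>T t\<close> with \<open>\<bar>\<mu>\<bar> \<noteq> 1\<close> can only come from the bounded operator \<open>A 0\<close>, to which the
  elementary spectral mapping theorem for \<open>exp\<close> applies. The unit circle is covered because \<open>L\<close> has
  the whole imaginary axis in its spectrum: \<open>p \<times> k\<close> takes arbitrarily large values, and truncated
  plane waves along lattice lines parallel to \<open>p\<close> are approximate eigenvectors.
\<close>

section \<open>Completeness and inner product\<close>

text \<open>For an unbounded generator only the inclusion of \<open>exp (t \<sigma>(L))\<close> in
  \<open>\<sigma>(T t)\<close> holds in general; the group may have spectrum that no spectral value
  of \<open>L\<close> explains. The proof confines such spectrum to the unit circle. The obstacle to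
  a bounded group is the disc |k| <= |p|, where 1/|p|^2 - 1/|k|^2 is not positive and the energy
  loses its sign. The disc is not invariant under the shifts by \<open>p\<close>, so a whole strip
  containing it is split off: by Cauchy-Schwarz |p x k| <= |p| |k|, hence the threshold |p|^2 for
  the innermost strip. The strip is infinite, but the coefficients of \<open>L\<close> are
  controlled by p x k, so \<open>L\<close> is bounded on it. On the complement the bound holds for
  positive and negative times alike, which excludes spectrum both outside and inside the
  circle.\<close>

lemma cmod_sq_summable: "(\<lambda>k. (cmod (coord x k))\<^sup>2) summable_on UNIV"
  using square_summable_coord[of x] by (simp add: square_summable_def)

lemma L2_set_le_norm: "finite F \<Longrightarrow> L2_set (\<lambda>k. cmod (coord w k)) F \<le> norm w"
  unfolding L2_set_def norm_ell2_def
  by (rule real_sqrt_le_mono, rule finite_sum_le_infsum) (use cmod_sq_summable in auto)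

lemma cmod_coord_le: "cmod (coord x k) \<le> norm x"
  using L2_set_le_norm[of "{k}" x] by simp

lemma norm_ell2_le:
  assumes "\<And>F. finite F \<Longrightarrow> L2_set (\<lambda>k. cmod (coord x k)) F \<le> B"
  shows "norm x \<le> B"
proof -
  have B: "0 \<le> B" using assms[of "{}"] by simp
  have "(\<Sum>\<^sub>\<infinity>k. (cmod (coord x k))\<^sup>2) \<le> B\<^sup>2"
  proof (rule infsum_le_finite_sums[OF cmod_sq_summable])
    fix F :: "'a set" assume "finite F"
    then have "(L2_set (\<lambda>k. cmod (coord x k)) F)\<^sup>2 \<le> B\<^sup>2"
      by (intro power_mono assms L2_set_nonneg)
    then show "(\<Sum>k\<in>F. (cmod (coord x k))\<^sup>2) \<le> B\<^sup>2"
      by (simp add: L2_set_def sum_nonneg)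
  qed
  then show ?thesis using B by (simp add: norm_ell2_def real_le_lsqrt)
qed

lemma coord_Abs_ell2:
  assumes "\<And>F. finite F \<Longrightarrow> L2_set (\<lambda>k. cmod (f k)) F \<le> B"
  shows "coord (Abs_ell2 f) = f" "norm (Abs_ell2 f) \<le> B"
proof -
  show c: "coord (Abs_ell2 f) = f"
    by (rule Abs_ell2_inverse) (use assms square_summable_iff_bound in auto)
  show "norm (Abs_ell2 f) \<le> B"
    by (rule norm_ell2_le) (simp add: c assms)
qed

instance ell2 :: (type) banach
proof
  fix X :: "nat \<Rightarrow> 'a ell2" assume "Cauchy X"
  have "Cauchy (\<lambda>n. coord (X n) k)" for k
  proof (rule metric_CauchyI)
    fix e :: real assume "0 < e"
    then obtain M where M: "\<forall>m\<ge>M. \<forall>n\<ge>M. dist (X m) (X n) < e"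
      using \<open>Cauchy X\<close> metric_CauchyD by blast
    have "dist (coord (X m) k) (coord (X n) k) \<le> dist (X m) (X n)" for m n
      using cmod_coord_le[of "X m - X n" k] by (simp add: dist_norm minus_ell2.rep_eq)
    then show "\<exists>M. \<forall>m\<ge>M. \<forall>n\<ge>M. dist (coord (X m) k) (coord (X n) k) < e"
      using M by (meson order_le_less_trans)
  qed
  then have "\<exists>l. (\<lambda>n. coord (X n) k) \<longlonglongrightarrow> l" for k
    using Cauchy_convergent convergent_def by blast
  then obtain f where f: "\<And>k. (\<lambda>n. coord (X n) k) \<longlonglongrightarrow> f k" by metis
  \<comment> \<open>Each estimate involves finitely many coordinates and so survives the
    coordinatewise limit; uniformity in \<open>F\<close> later turns it into a norm bound.\<close>
  have tail: "\<exists>M. \<forall>n\<ge>M. \<forall>F. finite F \<longrightarrow> L2_set (\<lambda>k. cmod (coord (X n) k - f k)) F \<le> e"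
    if "0 < e" for e
  proof -
    obtain M where M: "\<forall>m\<ge>M. \<forall>n\<ge>M. dist (X m) (X n) < e"
      using \<open>Cauchy X\<close> metric_CauchyD \<open>0 < e\<close> by blast
    have "L2_set (\<lambda>k. cmod (coord (X n) k - f k)) F \<le> e" if "n \<ge> M" "finite F" for n F
    proof (rule tendsto_upperbound)
      show "((\<lambda>m. L2_set (\<lambda>k. cmod (coord (X n) k - coord (X m) k)) F)
          \<longlongrightarrow> L2_set (\<lambda>k. cmod (coord (X n) k - f k)) F) sequentially"
        unfolding L2_set_def by (intro tendsto_intros f)
      have "L2_set (\<lambda>k. cmod (coord (X n) k - coord (X m) k)) F \<le> e" if "m \<ge> M" for m
        using L2_set_le_norm[OF \<open>finite F\<close>, of "X n - X m"] M \<open>n \<ge> M\<close> that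
        by (fastforce simp: dist_norm minus_ell2.rep_eq)
      then show "\<forall>\<^sub>F m in sequentially. L2_set (\<lambda>k. cmod (coord (X n) k - coord (X m) k)) F \<le> e"
        by (auto simp: eventually_sequentially)
    qed simp
    then show ?thesis by blast
  qed
  obtain M where M: "\<And>F. finite F \<Longrightarrow> L2_set (\<lambda>k. cmod (coord (X M) k - f k)) F \<le> 1"
    using tail[of 1] by auto
  have "L2_set (\<lambda>k. cmod (f k)) F \<le> norm (X M) + 1" if "finite F" for F
    using L2_set_cmod_add_le[of "coord (X M)" "\<lambda>k. f k - coord (X M) k" F]
      L2_set_le_norm[OF that, of "X M"] M[OF that]
    by (simp add: norm_minus_commute)
  then have cf: "coord (Abs_ell2 f) = f" by (rule coord_Abs_ell2)
  have "X \<longlonglongrightarrow> Abs_ell2 f"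
  proof (rule metric_LIMSEQ_I)
    fix e :: real assume "0 < e"
    then obtain M where M: "\<And>n F. n \<ge> M \<Longrightarrow> finite F \<Longrightarrow>
        L2_set (\<lambda>k. cmod (coord (X n) k - f k)) F \<le> e / 2"
      using tail[of "e/2"] by auto
    have "dist (X n) (Abs_ell2 f) \<le> e / 2" if "n \<ge> M" for n
      unfolding dist_norm by (rule norm_ell2_le) (use M[OF that] in \<open>simp add: minus_ell2.rep_eq cf\<close>)
    then show "\<exists>M. \<forall>n\<ge>M. dist (X n) (Abs_ell2 f) < e"
      using \<open>0 < e\<close> by (intro exI[of _ M]) fastforce
  qed
  then show "convergent X" by (auto simp: convergent_def)
qed

lemma inner_summable: "(\<lambda>k. Re (coord x k * cnj (coord y k))) summable_on UNIV"
proof -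
  have "(\<lambda>k. norm (Re (coord x k * cnj (coord y k)))) summable_on UNIV"
  proof (rule summable_on_comparison_test)
    show "(\<lambda>k. (cmod (coord x k))\<^sup>2 + (cmod (coord y k))\<^sup>2) summable_on UNIV"
      by (rule summable_on_add[OF cmod_sq_summable cmod_sq_summable])
    fix k
    have "\<bar>Re (coord x k * cnj (coord y k))\<bar> \<le> cmod (coord x k) * cmod (coord y k)"
      using abs_Re_le_cmod[of "coord x k * cnj (coord y k)"] by (simp add: norm_mult)
    also have "\<dots> \<le> (cmod (coord x k))\<^sup>2 + (cmod (coord y k))\<^sup>2"
      using sum_squares_bound[of "cmod (coord x k)" "cmod (coord y k)"]
        mult_nonneg_nonneg[OF norm_ge_zero[of "coord x k"] norm_ge_zero[of "coord y k"]]
      by linarith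
    finally show "norm (Re (coord x k * cnj (coord y k)))
        \<le> (cmod (coord x k))\<^sup>2 + (cmod (coord y k))\<^sup>2" by simp
  qed simp
  then show ?thesis by (rule abs_summable_summable)
qed

instantiation ell2 :: (type) real_inner
begin

text \<open>The real part of the Hermitian product: it induces the same norm and suffices for
  differentiating a squared norm in real time.\<close>

definition inner_ell2 :: "'a ell2 \<Rightarrow> 'a ell2 \<Rightarrow> real" where
  "inner_ell2 x y = (\<Sum>\<^sub>\<infinity>k. Re (coord x k * cnj (coord y k)))"

instance
proof
  fix x y z :: "'a ell2" and r :: real
  have sq: "Re (coord x k * cnj (coord x k)) = (cmod (coord x k))\<^sup>2" for x :: "'a ell2" and k
    by (metis Re_complex_of_real complex_norm_square)
  show "inner x y = inner y x"
    unfolding inner_ell2_def by (simp add: mult.commute)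
  show "inner (x + y) z = inner x z + inner y z"
    unfolding inner_ell2_def
    by (subst infsum_add[symmetric, OF inner_summable inner_summable])
      (simp add: plus_ell2.rep_eq algebra_simps)
  show "inner (r *\<^sub>R x) y = r * inner x y"
    unfolding inner_ell2_def
    by (subst infsum_cmult_right'[symmetric]) (simp add: scaleR_ell2.rep_eq algebra_simps)
  show n: "norm x = sqrt (inner x x)"
    unfolding inner_ell2_def norm_ell2_def sq ..
  show p: "0 \<le> inner x x"
    unfolding inner_ell2_def sq by (rule infsum_nonneg) simp
  show "inner x x = 0 \<longleftrightarrow> x = 0"
    using n p by (metis norm_eq_zero real_sqrt_eq_0_iff)
qed

end

section \<open>The algebra of bounded complex-linear operators\<close>

lemma scaleC_add_right: "c *\<^sub>C (x + y) = c *\<^sub>C x + c *\<^sub>C y"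
  by transfer (simp add: algebra_simps)

lemma scaleC_diff_right: "c *\<^sub>C (x - y) = c *\<^sub>C x - c *\<^sub>C y"
  by transfer (simp add: algebra_simps)

lemma scaleC_uminus_right: "c *\<^sub>C (- x) = - (c *\<^sub>C x)"
  by transfer simp

lemma scaleC_scaleR: "c *\<^sub>C (r *\<^sub>R x) = r *\<^sub>R (c *\<^sub>C x)"
  by transfer (simp add: algebra_simps)

lemma scaleC_scaleC [simp]: "c *\<^sub>C (d *\<^sub>C x) = (c * d) *\<^sub>C x"
  by transfer (simp add: algebra_simps)

lemma scaleC_add_left: "(c + d) *\<^sub>C x = c *\<^sub>C x + d *\<^sub>C x"
  by transfer (simp add: algebra_simps)

lemma scaleC_minus_left [simp]: "(- c) *\<^sub>C x = - (c *\<^sub>C x)"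
  by transfer simp

lemma scaleR_scaleC: "r *\<^sub>R c *\<^sub>C x = (of_real r * c) *\<^sub>C x"
  by transfer (simp add: mult.assoc)

lemma scaleC_zero [simp]: "c *\<^sub>C 0 = 0" "0 *\<^sub>C x = 0"
  by (transfer, simp)+

lemma scaleC_one [simp]: "1 *\<^sub>C x = x"
  by transfer simp

lemma scaleC_of_real [simp]: "of_real r *\<^sub>C x = r *\<^sub>R x"
  by transfer simp

lemma norm_scaleC [simp]: "norm (c *\<^sub>C x) = cmod c * norm x"
  by (simp add: norm_ell2_def scaleC.rep_eq norm_mult power_mult_distrib
      infsum_cmult_right' real_sqrt_mult)

lemma bounded_linear_scaleC: "bounded_linear (\<lambda>x. c *\<^sub>C x)"
  by (rule bounded_linear_intro[of _ "cmod c"])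
    (simp_all add: scaleC_add_right scaleC_scaleR)

lift_definition basis_vec :: "'a \<Rightarrow> 'a ell2" is "\<lambda>j k. if k = j then 1 else 0"
  unfolding square_summable_def
  by (rule finite_nonzero_values_imp_summable_on) simp

lemma norm_basis_vec [simp]: "norm (basis_vec j) = 1"
proof -
  have "(\<Sum>\<^sub>\<infinity>k. (cmod (coord (basis_vec j) k))\<^sup>2) = (\<Sum>\<^sub>\<infinity>k\<in>{j}. (cmod (coord (basis_vec j) k))\<^sup>2)"
    by (rule infsum_cong_neutral) (simp_all add: basis_vec.rep_eq)
  then show ?thesis unfolding norm_ell2_def by (simp add: basis_vec.rep_eq)
qed

lifting_forget ell2.lifting

text \<open>Turning the bounded complex-linear maps into a real Banach algebra makes
  \<open>exp\<close>, geometric series and integrals of operators available. Complex scalars enter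
  as the central elements \<open>scalar_op c\<close>.\<close>

typedef 'a cop = "{S :: 'a ell2 \<Rightarrow>\<^sub>L 'a ell2. \<forall>c x. S (c *\<^sub>C x) = c *\<^sub>C S x}"
  by (rule exI[of _ 0]) simp

setup_lifting type_definition_cop

lift_definition app :: "'a cop \<Rightarrow> 'a ell2 \<Rightarrow> 'a ell2" is blinfun_apply .

instantiation cop :: (type) real_normed_algebra_1
begin

lift_definition zero_cop :: "'a cop" is 0 by simp
lift_definition one_cop :: "'a cop" is id_blinfun by simp
lift_definition plus_cop :: "'a cop \<Rightarrow> 'a cop \<Rightarrow> 'a cop" is "(+)"
  by (simp add: plus_blinfun.rep_eq scaleC_add_right)
lift_definition minus_cop :: "'a cop \<Rightarrow> 'a cop \<Rightarrow> 'a cop" is "(-)"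
  by (simp add: minus_blinfun.rep_eq scaleC_diff_right)
lift_definition uminus_cop :: "'a cop \<Rightarrow> 'a cop" is uminus
  by (simp add: uminus_blinfun.rep_eq scaleC_uminus_right)
lift_definition times_cop :: "'a cop \<Rightarrow> 'a cop \<Rightarrow> 'a cop" is "(o\<^sub>L)" by simp
lift_definition scaleR_cop :: "real \<Rightarrow> 'a cop \<Rightarrow> 'a cop" is "(*\<^sub>R)"
  by (simp add: scaleR_blinfun.rep_eq scaleC_scaleR)
lift_definition norm_cop :: "'a cop \<Rightarrow> real" is norm .

definition sgn_cop :: "'a cop \<Rightarrow> 'a cop" where
  "sgn_cop x = inverse (norm x) *\<^sub>R x"

definition dist_cop :: "'a cop \<Rightarrow> 'a cop \<Rightarrow> real" where
  "dist_cop x y = norm (x - y)"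

definition uniformity_cop :: "('a cop \<times> 'a cop) filter" where
  "uniformity_cop = (INF e\<in>{0<..}. principal {(x, y). dist x y < e})"

definition open_cop :: "'a cop set \<Rightarrow> bool" where
  "open_cop U \<longleftrightarrow> (\<forall>x\<in>U. \<forall>\<^sub>F (x', y) in uniformity. x' = x \<longrightarrow> y \<in> U)"

instance
proof
  fix x y z :: "'a cop" and a b r :: real and U :: "'a cop set"
  show "x + y + z = x + (y + z)" by transfer simp
  show "x + y = y + x" by transfer simp
  show "0 + x = x" by transfer simp
  show "- x + x = 0" by transfer simp
  show "x - y = x + - y" by transfer simp
  show "a *\<^sub>R (x + y) = a *\<^sub>R x + a *\<^sub>R y" by transfer (simp add: algebra_simps)
  show "(a + b) *\<^sub>R x = a *\<^sub>R x + b *\<^sub>R x" by transfer (simp add: algebra_simps)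
  show "a *\<^sub>R b *\<^sub>R x = (a * b) *\<^sub>R x" by transfer simp
  show "1 *\<^sub>R x = x" by transfer simp
  show "x * y * z = x * (y * z)" by transfer (auto intro: blinfun_eqI)
  show "(x + y) * z = x * z + y * z"
    by transfer (auto intro: blinfun_eqI simp: plus_blinfun.rep_eq)
  show "x * (y + z) = x * y + x * z"
    by transfer (auto intro: blinfun_eqI simp: plus_blinfun.rep_eq blinfun.add_right)
  show "1 * x = x" by transfer (auto intro: blinfun_eqI)
  show "x * 1 = x" by transfer (auto intro: blinfun_eqI)
  show "a *\<^sub>R x * y = a *\<^sub>R (x * y)"
    by transfer (auto intro: blinfun_eqI simp: scaleR_blinfun.rep_eq)
  show "x * a *\<^sub>R y = a *\<^sub>R (x * y)"
    by transfer (auto intro: blinfun_eqI simp: scaleR_blinfun.rep_eq blinfun.scaleR_right)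
  show "sgn x = inverse (norm x) *\<^sub>R x" by (rule sgn_cop_def)
  show "dist x y = norm (x - y)" by (rule dist_cop_def)
  show "uniformity = (INF e\<in>{0<..}. principal {(x, y). dist (x::'a cop) y < e})"
    by (rule uniformity_cop_def)
  show "open U \<longleftrightarrow> (\<forall>x\<in>U. \<forall>\<^sub>F (x', y) in uniformity. x' = x \<longrightarrow> y \<in> U)"
    by (rule open_cop_def)
  show "norm x = 0 \<longleftrightarrow> x = 0" by transfer simp
  show "norm (x + y) \<le> norm x + norm y" by transfer (rule norm_triangle_ineq)
  show "norm (a *\<^sub>R x) = \<bar>a\<bar> * norm x" by transfer simp
  show "norm (x * y) \<le> norm x * norm y" by transfer (rule norm_blinfun_compose)
  show n1: "norm (1 :: 'a cop) = 1"
  proof transfer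
    have "norm (blinfun_apply id_blinfun (basis_vec (undefined :: 'a))) \<le> norm (id_blinfun :: 'a ell2 \<Rightarrow>\<^sub>L 'a ell2) * norm (basis_vec (undefined :: 'a))"
      by (rule norm_blinfun)
    then show "norm (id_blinfun :: 'a ell2 \<Rightarrow>\<^sub>L 'a ell2) = 1"
      using norm_blinfun_id_le[where 'a = "'a ell2"] by simp
  qed
  show "0 \<noteq> (1 :: 'a cop)"
  proof
    assume "0 = (1 :: 'a cop)"
    then have "norm (0 :: 'a cop) = 1" using n1 by simp
    then show False by transfer simp
  qed
qed

end

lemma app_simps [simp]:
  "app 0 x = 0" "app 1 x = x" "app (S + T) x = app S x + app T x"
  "app (S - T) x = app S x - app T x" "app (- S) x = - app S x"
  "app (S * T) x = app S (app T x)" "app (r *\<^sub>R S) x = r *\<^sub>R app S x"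
  "app S (c *\<^sub>C x) = c *\<^sub>C app S x"
  by (transfer, simp add: plus_blinfun.rep_eq minus_blinfun.rep_eq uminus_blinfun.rep_eq
      scaleR_blinfun.rep_eq)+

lemma cop_eqI: "(\<And>x. app S x = app T x) \<Longrightarrow> S = T"
  by transfer (rule blinfun_eqI)

lemma norm_app: "norm (app S x) \<le> norm S * norm x"
  by transfer (rule norm_blinfun)

lemma norm_cop_bound: "0 \<le> b \<Longrightarrow> (\<And>x. norm (app S x) \<le> b * norm x) \<Longrightarrow> norm S \<le> b"
  by transfer (rule norm_blinfun_bound)

lemma bounded_bilinear_app: "bounded_bilinear app"
proof
  show "\<exists>K. \<forall>a b. norm (app a b) \<le> norm a * norm b * K"
    by (rule exI[of _ 1]) (simp add: norm_app)
qed (transfer, simp add: blinfun.bilinear_simps)+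

lemmas app_right_simps [simp] =
  bounded_bilinear.add_right[OF bounded_bilinear_app]
  bounded_bilinear.diff_right[OF bounded_bilinear_app]
  bounded_bilinear.minus_right[OF bounded_bilinear_app]
  bounded_bilinear.scaleR_right[OF bounded_bilinear_app]
  bounded_bilinear.zero_right[OF bounded_bilinear_app]
  bounded_bilinear.sum_right[OF bounded_bilinear_app]

lemmas bounded_linear_app = bounded_bilinear.bounded_linear_right[OF bounded_bilinear_app]
lemmas bounded_linear_app_left = bounded_bilinear.bounded_linear_left[OF bounded_bilinear_app]

lemma bounded_clinear_app: "bounded_clinear (app S)"
  by (simp add: bounded_clinear_def bounded_linear_app)

lemma bounded_clinear_appE:
  assumes "bounded_clinear F"
  obtains S where "app S = F"
proof -
  have "Blinfun F \<in> {S :: 'a ell2 \<Rightarrow>\<^sub>L 'a ell2. \<forall>c x. S (c *\<^sub>C x) = c *\<^sub>C S x}"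
    using assms by (simp add: bounded_clinear_def bounded_linear_Blinfun_apply)
  then have "app (Abs_cop (Blinfun F)) = F"
    using assms by (simp add: app.rep_eq Abs_cop_inverse bounded_clinear_def bounded_linear_Blinfun_apply)
  then show thesis by (rule that)
qed

instance cop :: (type) banach
proof
  fix X :: "nat \<Rightarrow> 'a cop" assume X: "Cauchy X"
  have d: "dist (Rep_cop (X m)) (Rep_cop (X n)) = dist (X m) (X n)" for m n
    by (simp add: dist_norm norm_cop.rep_eq minus_cop.rep_eq)
  have "Cauchy (\<lambda>n. Rep_cop (X n))"
    using X unfolding Cauchy_def d .
  then obtain S where S: "(\<lambda>n. Rep_cop (X n)) \<longlonglongrightarrow> S"
    using Cauchy_convergent convergent_def by blast
  have "S (c *\<^sub>C x) = c *\<^sub>C S x" for c x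
  proof (rule LIMSEQ_unique)
    show "(\<lambda>n. Rep_cop (X n) (c *\<^sub>C x)) \<longlonglongrightarrow> S (c *\<^sub>C x)"
      by (intro blinfun.tendsto S tendsto_const)
    have "(\<lambda>n. c *\<^sub>C Rep_cop (X n) x) \<longlonglongrightarrow> c *\<^sub>C S x"
      by (intro bounded_linear.tendsto[OF bounded_linear_scaleC] blinfun.tendsto S tendsto_const)
    moreover have "Rep_cop (X n) (c *\<^sub>C x) = c *\<^sub>C Rep_cop (X n) x" for n
      using Rep_cop[of "X n"] by simp
    ultimately show "(\<lambda>n. Rep_cop (X n) (c *\<^sub>C x)) \<longlonglongrightarrow> c *\<^sub>C S x" by simp
  qed
  then have S': "Rep_cop (Abs_cop S) = S" by (simp add: Abs_cop_inverse)
  have "X \<longlonglongrightarrow> Abs_cop S"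
    using S unfolding tendsto_iff dist_norm norm_cop.rep_eq minus_cop.rep_eq S' .
  then show "convergent X" by (auto simp: convergent_def)
qed

lift_definition scalar_op :: "complex \<Rightarrow> 'a cop" is "\<lambda>c. Blinfun (\<lambda>x. c *\<^sub>C x)"
  by (simp add: bounded_linear_Blinfun_apply[OF bounded_linear_scaleC] mult.commute)

lemma app_scalar_op [simp]: "app (scalar_op c) x = c *\<^sub>C x"
  by transfer (simp add: bounded_linear_Blinfun_apply[OF bounded_linear_scaleC])

lemma scalar_op_simps:
  "scalar_op (c + d) = scalar_op c + scalar_op d" "scalar_op (c * d) = scalar_op c * scalar_op d"
  "scalar_op 1 = 1" "scalar_op 0 = 0" "scalar_op (of_real r) = r *\<^sub>R 1"
  by (rule cop_eqI, simp add: scaleC_add_left mult.commute)+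

lemma scalar_op_commute: "S * scalar_op c = scalar_op c * S"
  by (rule cop_eqI) simp

lemma norm_scalar_op [simp]: "norm (scalar_op c :: 'a cop) = cmod c"
proof (rule antisym)
  show "norm (scalar_op c :: 'a cop) \<le> cmod c" by (rule norm_cop_bound) auto
  show "cmod c \<le> norm (scalar_op c :: 'a cop)"
    using norm_app[of "scalar_op c :: 'a cop" "basis_vec undefined"] by simp
qed

lemma bounded_linear_scalar_op: "bounded_linear scalar_op"
  by (rule bounded_linear_intro[of _ 1])
    (simp_all add: scalar_op_simps scaleR_conv_of_real[where 'a = complex])

lemma scalar_op_exp: "scalar_op (exp z) = exp (scalar_op z)"
proof -
  have pow: "scalar_op (z ^ n) = scalar_op z ^ n" for n
    by (induction n) (simp_all add: scalar_op_simps)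
  have "(\<lambda>n. scalar_op (z ^ n /\<^sub>R fact n)) sums scalar_op (exp z)"
    by (rule bounded_linear.sums[OF bounded_linear_scalar_op exp_converges])
  then have "(\<lambda>n. scalar_op z ^ n /\<^sub>R fact n) sums scalar_op (exp z)"
    by (simp only: linear_scale[OF bounded_linear.linear[OF bounded_linear_scalar_op]] pow)
  then show ?thesis using exp_converges sums_unique2 by blast
qed

text \<open>Meaningful only for bounded \<open>a\<close> and injective \<open>f\<close>; otherwise an arbitrary operator.\<close>

definition wshift :: "('a \<Rightarrow> complex) \<Rightarrow> ('a \<Rightarrow> 'a) \<Rightarrow> 'a cop" where
  "wshift a f = (SOME S. \<forall>x k. coord (app S x) k = a k * coord x (f k))"

lemma wshift:
  assumes "inj f" and a: "\<And>k. cmod (a k) \<le> B"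
  shows coord_wshift: "coord (app (wshift a f) x) k = a k * coord x (f k)"
    and norm_wshift: "norm (app (wshift a f) x) \<le> B * norm x"
proof -
  define F where "F x = Abs_ell2 (\<lambda>k. a k * coord x (f k))" for x
  have B: "0 \<le> B" using a norm_ge_zero order_trans by blast
  have bd: "L2_set (\<lambda>k. cmod (a k * coord x (f k))) G \<le> B * norm x" if "finite G" for x G
  proof -
    have "L2_set (\<lambda>k. cmod (a k * coord x (f k))) G \<le> L2_set (\<lambda>k. B * cmod (coord x (f k))) G"
      by (rule L2_set_mono) (auto simp: norm_mult intro: mult_right_mono a)
    also have "\<dots> = B * L2_set (\<lambda>k. cmod (coord x (f k))) G"
      using B by (simp add: L2_set_right_distrib)
    also have "L2_set (\<lambda>k. cmod (coord x (f k))) G = L2_set (\<lambda>k. cmod (coord x k)) (f ` G)"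
      unfolding L2_set_def using \<open>inj f\<close> by (subst sum.reindex) (auto intro: inj_on_subset)
    also have "B * \<dots> \<le> B * norm x"
      by (rule mult_left_mono[OF L2_set_le_norm B]) (use that in simp)
    finally show ?thesis .
  qed
  have cF: "coord (F x) k = a k * coord x (f k)" for x k
    unfolding F_def by (subst coord_Abs_ell2[OF bd]) auto
  have nF: "norm (F x) \<le> B * norm x" for x
    unfolding F_def by (rule coord_Abs_ell2[OF bd])
  have "bounded_clinear F"
    unfolding bounded_clinear_def
    by (intro conjI allI bounded_linear_intro[of _ B] ell2_eqI)
      (use nF in \<open>simp_all add: cF plus_ell2.rep_eq scaleR_ell2.rep_eq scaleC.rep_eq algebra_simps\<close>)
  then obtain S where S: "app S = F" by (rule bounded_clinear_appE)
  have W: "\<forall>x k. coord (app (wshift a f) x) k = a k * coord x (f k)"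
    unfolding wshift_def by (rule someI[of _ S]) (simp add: S cF)
  then show "coord (app (wshift a f) x) k = a k * coord x (f k)" by blast
  have "app (wshift a f) x = F x" by (rule ell2_eqI) (simp add: W cF)
  then show "norm (app (wshift a f) x) \<le> B * norm x" using nF by simp
qed

definition proj :: "'a set \<Rightarrow> 'a cop" where
  "proj K = wshift (\<lambda>k. if k \<in> K then 1 else 0) id"

lemma coord_proj [simp]: "coord (app (proj K) x) k = (if k \<in> K then coord x k else 0)"
  unfolding proj_def by (subst coord_wshift[where B = 1]) auto

lemma norm_proj: "norm (app (proj K) x) \<le> norm x"
  unfolding proj_def by (rule order_trans[OF norm_wshift[where B = 1]]) auto

lemma proj_mult: "proj K * proj J = proj (K \<inter> J)"
  by (rule cop_eqI, rule ell2_eqI) simp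

section \<open>Exponentials in Banach algebras\<close>

definition invertible_elem :: "'a::monoid_mult \<Rightarrow> bool" where
  "invertible_elem a \<longleftrightarrow> (\<exists>b. a * b = 1 \<and> b * a = 1)"

lemma invertible_elem_mult:
  assumes "invertible_elem a" "invertible_elem b" shows "invertible_elem (a * b)"
proof -
  obtain a' b' where "a * a' = 1" "a' * a = 1" "b * b' = 1" "b' * b = 1"
    using assms unfolding invertible_elem_def by blast
  then have "(a * b) * (b' * a') = 1" "(b' * a') * (a * b) = 1"
    by (metis mult.assoc mult_1_right)+
  then show ?thesis unfolding invertible_elem_def by blast
qed

lemma invertible_scaleR:
  fixes a :: "'a::real_algebra_1"
  assumes "invertible_elem a" "r \<noteq> 0" shows "invertible_elem (r *\<^sub>R a)"
proof -
  obtain b where "a * b = 1" "b * a = 1" using assms unfolding invertible_elem_def by blast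
  then have "(r *\<^sub>R a) * (inverse r *\<^sub>R b) = 1" "(inverse r *\<^sub>R b) * (r *\<^sub>R a) = 1"
    using \<open>r \<noteq> 0\<close> by auto
  then show ?thesis unfolding invertible_elem_def by blast
qed

text \<open>Summability of the powers is assumed instead of \<open>norm x < 1\<close> because the
  application, \<open>invertible_off_zero\<close>, has powers that decay geometrically only up to a
  constant factor, so that \<open>x\<close> itself may have norm above 1.\<close>

lemma neumann_series:
  fixes x :: "'a::{real_normed_algebra_1,banach}"
  assumes "summable (\<lambda>n. x ^ n)"
  shows "invertible_elem (1 - x)"
proof -
  define S where "S = (\<Sum>n. x ^ n)"
  have tail: "(\<Sum>n. x ^ Suc n) = S - 1"
    using suminf_split_head[OF assms] by (simp add: S_def)
  have "x * S = S - 1"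
    using suminf_mult[OF assms, of x] tail by (simp add: S_def)
  moreover have "S * x = S - 1"
    using suminf_mult2[OF assms, of x] tail by (simp add: S_def power_commutes)
  ultimately have "(1 - x) * S = 1 \<and> S * (1 - x) = 1" by (simp add: algebra_simps)
  then show ?thesis unfolding invertible_elem_def by blast
qed

lemma invertible_near_one:
  fixes x :: "'a::{real_normed_algebra_1,banach}"
  assumes "norm (x - 1) < 1" shows "invertible_elem x"
  using neumann_series[OF complete_algebra_summable_geometric, of "1 - x"] assms
  by (simp add: norm_minus_commute)

text \<open>Termwise in the series. Allowing two different elements \<open>a\<close> and
  \<open>b\<close> is what relates the exponentials of different truncations through a
  projection.\<close>

lemma exp_intertwine:
  fixes a b p :: "'a::{real_normed_algebra_1,banach}"
  assumes "p * a = b * p" shows "p * exp a = exp b * p"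
proof -
  have pow: "p * a ^ n = b ^ n * p" for n
    by (induction n) (simp, metis assms mult.assoc power_Suc power_Suc2)
  have "(\<lambda>n. p * (a ^ n /\<^sub>R fact n)) sums (p * exp a)"
    by (rule sums_mult[OF exp_converges])
  moreover have "(\<lambda>n. (b ^ n /\<^sub>R fact n) * p) sums (exp b * p)"
    by (rule sums_mult2[OF exp_converges])
  ultimately show ?thesis by (simp add: pow sums_unique2)
qed

lemma continuous_on_exp_scaleR:
  fixes c :: "'a::{real_normed_algebra_1,banach}"
  shows "continuous_on S (\<lambda>s. exp (s *\<^sub>R c))"
  by (intro continuous_at_imp_continuous_on ballI
      has_vector_derivative_continuous[OF exp_scaleR_has_vector_derivative_left])

text \<open>The entire function (exp c - 1) / c. The integral form needs no inverse of
  \<open>c\<close> and inherits every bound that holds for \<open>exp (s c)\<close> uniformly over 0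
  <= s <= 1.\<close>

definition exp_mean :: "'a::{real_normed_algebra_1,banach} \<Rightarrow> 'a" where
  "exp_mean c = integral {0..1} (\<lambda>s. exp (s *\<^sub>R c))"

lemma exp_mean_has_integral: "((\<lambda>s. exp (s *\<^sub>R c)) has_integral exp_mean c) {0..1}"
  unfolding exp_mean_def
  by (intro integrable_integral integrable_continuous_interval continuous_on_exp_scaleR)

lemma exp_mean_mult: "c * exp_mean c = exp c - 1" "exp_mean c * c = exp c - 1"
proof -
  have "((\<lambda>s. c * exp (s *\<^sub>R c)) has_integral c * exp_mean c) {0..1}"
    by (rule has_integral_mult_right[OF exp_mean_has_integral])
  moreover have "((\<lambda>s. c * exp (s *\<^sub>R c)) has_integral exp (1 *\<^sub>R c) - exp (0 *\<^sub>R c)) {0..1}"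
    by (rule fundamental_theorem_of_calculus)
      (auto intro: has_vector_derivative_at_within exp_scaleR_has_vector_derivative_left)
  ultimately show "c * exp_mean c = exp c - 1" by (simp add: has_integral_unique)
  have "((\<lambda>s. exp (s *\<^sub>R c) * c) has_integral exp_mean c * c) {0..1}"
    by (rule has_integral_mult_left[OF exp_mean_has_integral])
  moreover have "((\<lambda>s. exp (s *\<^sub>R c) * c) has_integral exp (1 *\<^sub>R c) - exp (0 *\<^sub>R c)) {0..1}"
    by (rule fundamental_theorem_of_calculus)
      (auto intro: has_vector_derivative_at_within exp_scaleR_has_vector_derivative_right)
  ultimately show "exp_mean c * c = exp c - 1" by (simp add: has_integral_unique)
qed

lemma exp_mean_intertwine:
  assumes "p * a = b * p" shows "p * exp_mean a = exp_mean b * p"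
proof (rule has_integral_unique)
  show "((\<lambda>s. p * exp (s *\<^sub>R a)) has_integral p * exp_mean a) {0..1}"
    by (rule has_integral_mult_right[OF exp_mean_has_integral])
  have "p * exp (s *\<^sub>R a) = exp (s *\<^sub>R b) * p" for s
    by (rule exp_intertwine) (simp add: assms)
  then show "((\<lambda>s. p * exp (s *\<^sub>R a)) has_integral exp_mean b * p) {0..1}"
    by (simp add: has_integral_mult_left[OF exp_mean_has_integral])
qed

lemma norm_exp_mean_diff:
  assumes "\<And>s. 0 \<le> s \<Longrightarrow> s \<le> 1 \<Longrightarrow> norm (exp (s *\<^sub>R c) - d) \<le> K"
  shows "norm (exp_mean c - d) \<le> K"
proof -
  have "((\<lambda>s. exp (s *\<^sub>R c) - d) has_integral exp_mean c - d) {0..1}"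
    using has_integral_diff[OF exp_mean_has_integral has_integral_const_real[of d 0 1]] by simp
  moreover have "0 \<le> K" by (rule order_trans[OF norm_ge_zero assms[of 0]]) auto
  ultimately show ?thesis
    using has_integral_bound[of K "\<lambda>s. exp (s *\<^sub>R c) - d" _ 0 1] assms by simp
qed

lemma norm_exp_diff_one: "norm (exp c - 1) \<le> norm c * exp (norm c)"
  for c :: "'a::{real_normed_algebra_1,banach}"
proof -
  have "norm (exp_mean c - 0) \<le> exp (norm c)"
  proof (rule norm_exp_mean_diff)
    fix s :: real assume "0 \<le> s" "s \<le> 1"
    then have "norm (s *\<^sub>R c) \<le> norm c" by (simp add: mult_left_le_one_le)
    then have "exp (norm (s *\<^sub>R c)) \<le> exp (norm c)" by (simp only: exp_le_cancel_iff)
    then show "norm (exp (s *\<^sub>R c) - 0) \<le> exp (norm c)"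
      unfolding diff_zero by (rule order_trans[OF norm_exp])
  qed
  then show ?thesis
    unfolding exp_mean_mult(1)[symmetric]
    by (simp add: order_trans[OF norm_mult_ineq] mult_left_mono)
qed

lemma norm_exp_mean_diff_one: "norm (exp_mean c - 1) \<le> norm c * exp (norm c)"
proof (rule norm_exp_mean_diff)
  fix s :: real assume "0 \<le> s" "s \<le> 1"
  then have "norm (s *\<^sub>R c) \<le> norm c" by (simp add: mult_left_le_one_le)
  then have "norm (s *\<^sub>R c) * exp (norm (s *\<^sub>R c)) \<le> norm c * exp (norm c)"
    by (intro mult_mono) auto
  then show "norm (exp (s *\<^sub>R c) - 1) \<le> norm c * exp (norm c)"
    using norm_exp_diff_one order_trans by blast
qed

section \<open>Spectral mapping for the exponential of a bounded operator\<close>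

lemma invertible_scalar_op: "z \<noteq> 0 \<Longrightarrow> invertible_elem (scalar_op z)"
  unfolding invertible_elem_def
  by (rule exI[of _ "scalar_op (1 / z)"]) (simp add: scalar_op_simps[symmetric])

lemma exp_half_bound: "exp (1/2 :: real) < 2"
proof -
  have "exp (1/2 :: real) \<le> 1 + 1/2 + (1/2)\<^sup>2" by (rule exp_bound) auto
  also have "\<dots> < 2" by (simp add: power2_eq_square)
  finally show ?thesis .
qed

lemma norm_mult_exp_le:
  fixes c :: "'a::real_normed_vector"
  assumes "norm c \<le> 1/2" shows "norm c * exp (norm c) \<le> 2 * norm c"
proof -
  have "exp (norm c) \<le> exp (1/2)" using assms by simp
  then have "exp (norm c) \<le> 2" using exp_half_bound by linarith
  then show ?thesis using mult_left_mono[of "exp (norm c)" 2 "norm c"] by simp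
qed

text \<open>
  Near 1 write \<open>\<nu> = exp w\<close> with \<open>w\<close> small; then \<open>exp (c - w) - 1 = (c - w) * exp_mean (c - w)\<close>,
  and the second factor is close to 1. Away from 1 a Neumann series suffices.
\<close>

lemma invertible_exp_small:
  fixes c :: "'a cop"
  assumes small: "norm c \<le> 1/16" and "\<nu> \<noteq> 0" and inv: "invertible_elem (scalar_op (Ln \<nu>) - c)"
  shows "invertible_elem (scalar_op \<nu> - exp c)"
proof (cases "cmod (\<nu> - 1) \<le> 1/8")
  \<comment> \<open>The threshold 1/8 serves both cases. Below it \<open>Ln \<nu>\<close> has
    modulus at most 1/4, so \<open>c - scalar_op (Ln \<nu>)\<close> has norm at most 5/16 and twice
    that is still below 1. Above it, \<open>norm (exp c - 1)\<close> is at most 2/16, hence less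
    than \<open>cmod (\<nu> - 1)\<close>.\<close>
  case True
  define w where "w = Ln \<nu>"
  have w: "exp w = \<nu>" using \<open>\<nu> \<noteq> 0\<close> by (simp add: w_def)
  have "cmod (Ln (1 + (\<nu> - 1))) \<le> 2 * cmod (\<nu> - 1)"
    by (rule norm_Ln_le) (use True in simp)
  then have "cmod w \<le> 1/4" using True by (simp add: w_def)
  then have "norm (c - scalar_op w) \<le> 5/16"
    using small norm_triangle_ineq4[of c "scalar_op w"] by simp
  then have "norm (exp_mean (c - scalar_op w) - 1) < 1"
    using norm_exp_mean_diff_one[of "c - scalar_op w"] norm_mult_exp_le[of "c - scalar_op w"]
    by linarith
  then have m: "invertible_elem (exp_mean (c - scalar_op w))" by (rule invertible_near_one)
  have "exp (c - scalar_op w + scalar_op w) = exp (c - scalar_op w) * exp (scalar_op w)"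
    by (rule exp_add_commuting) (simp add: left_diff_distrib right_diff_distrib scalar_op_commute[of c])
  then have "exp c = exp (c - scalar_op w) * scalar_op \<nu>"
    by (simp add: scalar_op_exp[symmetric] w)
  then have "scalar_op \<nu> - exp c = (scalar_op w - c) * exp_mean (c - scalar_op w) * scalar_op \<nu>"
    using arg_cong[OF exp_mean_mult(1)[of "c - scalar_op w"], of "\<lambda>y. - (y * scalar_op \<nu>)"]
    by (simp add: left_diff_distrib)
  then show ?thesis
    using m inv \<open>\<nu> \<noteq> 0\<close>
    by (simp add: invertible_elem_mult invertible_scalar_op w_def)
next
  case False
  then have ne: "\<nu> - 1 \<noteq> 0" by auto
  define x where "x = scalar_op (1 / (\<nu> - 1)) * (exp c - 1)"
  have "norm (exp c - 1) \<le> 1/8"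
    using norm_exp_diff_one[of c] norm_mult_exp_le[of c] small by linarith
  moreover have "norm x \<le> (1 / cmod (\<nu> - 1)) * norm (exp c - 1)"
    using norm_mult_ineq[of "scalar_op (1 / (\<nu> - 1))" "exp c - 1"] by (simp add: x_def norm_divide)
  moreover have "(1 / cmod (\<nu> - 1)) * (1/8) < 1" using False ne by (simp add: divide_less_eq)
  ultimately have "norm x < 1"
    using mult_left_mono[of "norm (exp c - 1)" "1/8" "1 / cmod (\<nu> - 1)"] by simp
  then have "norm ((1 - x) - 1) < 1" by simp
  then have "invertible_elem (1 - x)" by (rule invertible_near_one)
  moreover have "scalar_op \<nu> - exp c = scalar_op (\<nu> - 1) * (1 - x)"
  proof -
    have "scalar_op (\<nu> - 1) * x = exp c - 1"
      unfolding x_def mult.assoc[symmetric] scalar_op_simps(2)[symmetric]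
      using ne by (simp add: scalar_op_simps(3))
    moreover have "scalar_op (\<nu> - 1) = scalar_op \<nu> - (1 :: 'a cop)"
      using scalar_op_simps(1)[of "\<nu> - 1" 1, where ?'a = 'a] by (simp add: scalar_op_simps(3))
    ultimately show ?thesis by (simp add: right_diff_distrib)
  qed
  ultimately show ?thesis using ne by (simp add: invertible_elem_mult invertible_scalar_op)
qed

text \<open>The induction hypothesis is used for the square of \<open>b\<close>, hence the
  generalisation over \<open>b\<close>. Both square roots of a root \<nu> are admissible in the
  premise because the exponent \<open>2 ^ Suc m\<close> is even.\<close>

lemma invertible_power_two_power:
  fixes b :: "'a cop"
  assumes "\<And>\<nu>. \<nu> ^ (2 ^ m) = \<mu> \<Longrightarrow> invertible_elem (scalar_op \<nu> - b)"
  shows "invertible_elem (scalar_op \<mu> - b ^ (2 ^ m))"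
  using assms
proof (induction m arbitrary: b)
  case 0
  then show ?case by simp
next
  case (Suc m)
  have "invertible_elem (scalar_op \<nu> - b\<^sup>2)" if "\<nu> ^ (2 ^ m) = \<mu>" for \<nu>
  proof -
    define \<kappa> where "\<kappa> = csqrt \<nu>"
    have k: "\<kappa>\<^sup>2 = \<nu>" by (simp add: \<kappa>_def)
    have "\<kappa> ^ (2 ^ Suc m) = \<mu>" "(- \<kappa>) ^ (2 ^ Suc m) = \<mu>"
      using that k by (simp_all add: power_mult)
    then have "invertible_elem (scalar_op \<kappa> - b)" "invertible_elem (scalar_op (- \<kappa>) - b)"
      using Suc.prems by blast+
    then have "invertible_elem ((-1) *\<^sub>R ((scalar_op \<kappa> - b) * (scalar_op (- \<kappa>) - b)))"
      by (intro invertible_scaleR invertible_elem_mult) auto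
    moreover have "scalar_op (- \<kappa>) = - (scalar_op \<kappa> :: 'a cop)"
      by (rule linear_neg[OF bounded_linear.linear[OF bounded_linear_scalar_op]])
    moreover have "scalar_op \<kappa> * scalar_op \<kappa> = (scalar_op \<nu> :: 'a cop)"
      by (simp add: scalar_op_simps(2)[symmetric] k[unfolded power2_eq_square])
    ultimately show ?thesis
      by (simp add: left_diff_distrib right_diff_distrib scalar_op_commute[of b] power2_eq_square[of b])
  qed
  then have "invertible_elem (scalar_op \<mu> - (b\<^sup>2) ^ (2 ^ m))" by (rule Suc.IH)
  then show ?case by (simp add: power_mult)
qed

text \<open>
  With \<open>b = exp (t a / 2^m)\<close> and \<open>t a / 2^m\<close> small, repeated use of
  \<open>\<kappa>\<^sup>2 - b\<^sup>2 = (\<kappa> - b) (\<kappa> + b)\<close> reduces \<open>\<mu> - b^(2^m)\<close> to the factors \<open>\<nu> - b\<close>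
  with \<open>\<nu>^(2^m) = \<mu>\<close>.
\<close>

lemma invertible_exp:
  fixes a :: "'a cop" and t :: real
  assumes "t \<noteq> 0" "\<mu> \<noteq> 0"
    and inv: "\<And>z. exp (of_real t * z) = \<mu> \<Longrightarrow> invertible_elem (scalar_op z - a)"
  shows "invertible_elem (scalar_op \<mu> - exp (t *\<^sub>R a))"
proof -
  obtain m :: nat where m: "16 * norm (t *\<^sub>R a) < 2 ^ m"
    using real_arch_pow[of 2] by fastforce
  define c where "c = (1 / 2 ^ m) *\<^sub>R t *\<^sub>R a"
  have "exp ((2 ^ n) *\<^sub>R c) = exp c ^ (2 ^ n)" for n :: nat
  proof (induction n)
    case (Suc n)
    have "exp ((2 ^ Suc n) *\<^sub>R c) = exp ((2 ^ n) *\<^sub>R c + (2 ^ n) *\<^sub>R c)"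
      by (simp flip: scaleR_add_left)
    also have "\<dots> = exp c ^ (2 ^ Suc n)"
      by (simp add: exp_add_commuting Suc power_add[symmetric] mult_2)
    finally show ?case .
  qed simp
  moreover have "(2 ^ m) *\<^sub>R c = t *\<^sub>R a"
    unfolding c_def by simp
  moreover have "invertible_elem (scalar_op \<nu> - exp c)" if \<nu>: "\<nu> ^ (2 ^ m) = \<mu>" for \<nu>
  proof (rule invertible_exp_small)
    show "norm c \<le> 1/16" using m by (simp add: c_def field_simps)
    show "\<nu> \<noteq> 0" using \<nu> \<open>\<mu> \<noteq> 0\<close> by auto
    \<comment> \<open>Chosen so that \<open>t z / 2 ^ m\<close> is the principal logarithm of \<nu>.
      Then \<open>exp (t z)\<close> is the \<open>2 ^ m\<close>-th power of \<nu>, that is \<mu>, so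
      the hypothesis on \<open>a\<close> applies at \<open>z\<close>.\<close>
    define z where "z = 2 ^ m * Ln \<nu> / of_real t"
    have "exp (of_real t * z) = exp (of_nat (2 ^ m) * Ln \<nu>)"
      using \<open>t \<noteq> 0\<close> by (simp add: z_def)
    also have "\<dots> = exp (Ln \<nu>) ^ (2 ^ m)" by (rule exp_of_nat_mult)
    also have "\<dots> = \<mu>" using \<nu> \<open>\<nu> \<noteq> 0\<close> by simp
    finally have "invertible_elem ((t / 2 ^ m) *\<^sub>R (scalar_op z - a))"
      using \<open>t \<noteq> 0\<close> by (intro invertible_scaleR inv) auto
    moreover have "(t / 2 ^ m) *\<^sub>R scalar_op z = (scalar_op (Ln \<nu>) :: 'a cop)"
      by (rule cop_eqI) (simp add: z_def scaleC_of_real[symmetric] \<open>t \<noteq> 0\<close> del: scaleC_of_real)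
    ultimately show "invertible_elem (scalar_op (Ln \<nu>) - c)"
      by (simp add: c_def scaleR_diff_right mult.commute)
  qed
  ultimately show ?thesis using invertible_power_two_power[of m \<mu> "exp c"] by metis
qed

section \<open>Operators exhausted by bounded pieces\<close>

lemma norm_proj_le: "norm (proj J) \<le> 1"
  by (rule norm_cop_bound) (simp_all add: norm_proj)

lemma resolvent_set_app: "resolvent_set UNIV (app S) = {z. invertible_elem (scalar_op z - S)}"
proof (intro set_eqI iffI)
  fix z assume "z \<in> resolvent_set UNIV (app S)"
  then obtain F where F: "bounded_clinear F" "\<And>y. z *\<^sub>C F y - app S (F y) = y"
    "\<And>x. F (z *\<^sub>C x - app S x) = x"
    unfolding resolvent_set_def by blast
  obtain R where "app R = F" by (rule bounded_clinear_appE[OF F(1)])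
  then have "(scalar_op z - S) * R = 1" "R * (scalar_op z - S) = 1"
    using F(2,3) by (auto intro!: cop_eqI)
  then show "z \<in> {z. invertible_elem (scalar_op z - S)}"
    unfolding invertible_elem_def by blast
next
  fix z assume "z \<in> {z. invertible_elem (scalar_op z - S)}"
  then obtain R where R: "(scalar_op z - S) * R = 1" "R * (scalar_op z - S) = 1"
    unfolding invertible_elem_def by blast
  have "z *\<^sub>C app R y - app S (app R y) = y" for y
    using arg_cong[OF R(1), of "\<lambda>T. app T y"] by simp
  moreover have "app R (z *\<^sub>C y - app S y) = y" for y
    using arg_cong[OF R(2), of "\<lambda>T. app T y"] by simp
  ultimately show "z \<in> resolvent_set UNIV (app S)"
    unfolding resolvent_set_def using bounded_clinear_app[of R] by blast
qed

lemma has_vector_derivative_at_zeroI: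
  fixes f :: "real \<Rightarrow> 'b::real_normed_vector"
  assumes "\<And>h. f h - f 0 = h *\<^sub>R g h" and "(g \<longlongrightarrow> y) (at 0)"
  shows "(f has_vector_derivative y) (at 0)"
proof -
  have "((\<lambda>h. norm (g h - y)) \<longlongrightarrow> 0) (at 0)"
    using assms(2) by (simp add: tendsto_norm_zero_iff LIM_zero_iff)
  moreover have "\<forall>\<^sub>F h in at 0. norm (g h - y) = norm (f (0 + h) - f 0 - h *\<^sub>R y) / norm h"
    using assms(1) by (auto simp: eventually_at_filter scaleR_diff_right[symmetric])
  ultimately have "((\<lambda>h. norm (f (0 + h) - f 0 - h *\<^sub>R y) / norm h) \<longlongrightarrow> 0) (at 0)"
    using tendsto_cong by force
  then show ?thesis
    by (simp add: has_vector_derivative_def has_derivative_at bounded_linear_scaleR_left)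
qed

lemma app_exp_derivative:
  "((\<lambda>t. app (exp (t *\<^sub>R B)) y) has_vector_derivative app (B * exp (s *\<^sub>R B)) y) (at s)"
  by (rule bounded_linear.has_vector_derivative[OF bounded_linear_app_left
        exp_scaleR_has_vector_derivative_left])

text \<open>With m = n the two product laws say that \<open>A n\<close> lives on \<open>H n\<close>;
  with m < n they say that it restricts to \<open>A m\<close> without coupling \<open>H m\<close> to
  the rest. The assumption \<open>graph\<close> expresses that \<open>L\<close> has its maximal
  domain: membership and value are both tested piece by piece. In \<open>off_zero\<close> the
  constant depends neither on \<open>n\<close> nor on \<open>t\<close>.\<close>

locale exhausted_operator =
  fixes H :: "nat \<Rightarrow> 'a set" and A :: "nat \<Rightarrow> 'a cop"
    and D :: "'a ell2 set" and L :: "'a ell2 \<Rightarrow> 'a ell2" and C :: real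
  assumes H_mono: "m \<le> n \<Longrightarrow> H m \<subseteq> H n"
    and H_cover: "\<exists>n. k \<in> H n"
    and A_proj: "m \<le> n \<Longrightarrow> A n * proj (H m) = A m"
    and proj_A: "m \<le> n \<Longrightarrow> proj (H m) * A n = A m"
    and graph: "x \<in> D \<and> L x = y \<longleftrightarrow> (\<forall>n. app (A n) x = app (proj (H n)) y)"
    and off_zero: "norm (exp (t *\<^sub>R A n) * (1 - proj (H 0))) \<le> C"
begin

abbreviation "P n \<equiv> proj (H n)"

lemma P_P: "m \<le> n \<Longrightarrow> P m * P n = P m" "m \<le> n \<Longrightarrow> P n * P m = P m" "P n * P n = P n"
  using H_mono by (simp_all add: proj_mult Int_absorb1 Int_absorb2)

lemma eq_by_proj:
  assumes "\<And>n. app (P n) x = app (P n) y" shows "x = y"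
proof (rule ell2_eqI)
  fix k
  obtain n where "k \<in> H n" using H_cover by blast
  then show "coord x k = coord y k" using arg_cong[OF assms[of n], of "\<lambda>w. coord w k"] by simp
qed

lemma cop_eq_by_proj:
  assumes "\<And>n. P n * S = P n * T" shows "S = T"
  by (rule cop_eqI, rule eq_by_proj) (use assms in \<open>metis app_simps(6)\<close>)

lemma proj_tendsto: "(\<lambda>n. app (P n) x) \<longlonglongrightarrow> x"
proof (rule LIMSEQ_I)
  fix e :: real assume e: "0 < e"
  let ?f = "\<lambda>k. (cmod (coord x k))\<^sup>2"
  have "(sum ?f \<longlongrightarrow> infsum ?f UNIV) (finite_subsets_at_top UNIV)"
    using infsum_tendsto[OF cmod_sq_summable[of x]] .
  then have "\<forall>\<^sub>F F in finite_subsets_at_top UNIV. dist (sum ?f F) (infsum ?f UNIV) < e\<^sup>2"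
    using e by (intro tendstoD) auto
  then obtain F where F: "finite F" "dist (sum ?f F) (infsum ?f UNIV) < e\<^sup>2"
    unfolding eventually_finite_subsets_at_top by blast
  have "\<forall>k. \<exists>n. k \<in> H n" using H_cover by blast
  then obtain lev where lev: "\<And>k. k \<in> H (lev k)" by metis
  define N where "N = Max (lev ` F)"
  have "norm (app (P n) x - x) < e" if "n \<ge> N" for n
  proof -
    have "F \<subseteq> H n"
    proof
      fix k assume "k \<in> F"
      then have "lev k \<le> n" using F(1) that by (metis N_def Max_ge finite_imageI imageI order_trans)
      then show "k \<in> H n" using lev H_mono by blast
    qed
    have "norm (app (P n) x - x) = sqrt (\<Sum>\<^sub>\<infinity>k. (cmod (coord (app (P n) x - x) k))\<^sup>2)"
      by (simp add: norm_ell2_def)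
    also have "(\<Sum>\<^sub>\<infinity>k. (cmod (coord (app (P n) x - x) k))\<^sup>2) \<le> (\<Sum>\<^sub>\<infinity>k\<in>UNIV - F. ?f k)"
      by (rule infsum_mono_neutral[OF cmod_sq_summable summable_on_subset_banach[OF cmod_sq_summable]])
        (use \<open>F \<subseteq> H n\<close> in \<open>auto simp: minus_ell2.rep_eq norm_minus_commute\<close>)
    also have "\<dots> = infsum ?f UNIV - sum ?f F"
      using F(1) by (subst infsum_Diff[OF cmod_sq_summable]) simp_all
    also have "\<dots> < e\<^sup>2" using F(2) by (simp add: dist_real_def)
    finally show ?thesis using e by (simp add: real_less_lsqrt)
  qed
  then show "\<exists>N. \<forall>n\<ge>N. norm (app (P n) x - x) < e" by blast
qed

text \<open>The restriction to \<open>P m\<close> on the right is essential: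
  \<open>exp (A n)\<close> is the identity off \<open>H n\<close> rather than zero, so exponentials
  of different truncations agree only on the smaller piece.\<close>

definition compat :: "(nat \<Rightarrow> 'a cop) \<Rightarrow> bool" where
  "compat Q \<longleftrightarrow> (\<forall>m n. m \<le> n \<longrightarrow> P m * Q n = Q m * P m \<and> Q n * P m = Q m * P m)"

lemma compatD:
  assumes "compat Q" "m \<le> n"
  shows "P m * Q n = Q m * P m" "Q n * P m = Q m * P m"
  using assms unfolding compat_def by blast+

lemma compat_A: "compat (\<lambda>n. r *\<^sub>R A n)" "compat (\<lambda>n. r *\<^sub>R (A n - scalar_op z))"
  by (simp_all add: compat_def A_proj proj_A scalar_op_commute[of "proj _"] algebra_simps)

text \<open>Compatibility reduces to three relations of the form p a = b p, so every function of an
  operator that respects such relations preserves it. The instances are \<open>exp\<close> and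
  \<open>exp_mean\<close>.\<close>

lemma compat_transfer:
  assumes "compat Q" and "\<And>p a b. p * a = b * p \<Longrightarrow> p * F a = F b * p"
  shows "compat (\<lambda>n. F (Q n))"
  unfolding compat_def
proof (intro allI impI conjI)
  fix m n :: nat assume mn: "m \<le> n"
  have Q: "P m * Q n = Q m * P m" "Q n * P m = P m * Q m" "P m * Q m = Q m * P m"
    using compatD[OF assms(1) mn] compatD[OF assms(1) order_refl] by simp_all
  show "P m * F (Q n) = F (Q m) * P m" by (rule assms(2)[OF Q(1)])
  have "P m * F (Q m) = F (Q n) * P m" by (rule assms(2)[OF Q(2)[symmetric]])
  then show "F (Q n) * P m = F (Q m) * P m" using assms(2)[OF Q(3)] by simp
qed

text \<open>Coordinate \<open>k\<close> of \<open>Q n x\<close> is the same for all \<open>n\<close>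
  with \<open>k\<close> in \<open>H n\<close>, so the glued operator is defined coordinate by
  coordinate and no limit is taken. Any finite set of coordinates lies in a single
  \<open>H N\<close>, where the bound on \<open>Q N\<close> gives the norm estimate.\<close>

lemma glue:
  assumes Q: "compat Q" and B: "\<And>n. norm (Q n) \<le> B"
  obtains S where "\<And>n. P n * S = Q n * P n" "\<And>n. S * P n = Q n * P n" "norm S \<le> B"
proof -
  have "\<forall>k. \<exists>n. k \<in> H n" using H_cover by blast
  then obtain lev where lev: "\<And>k. k \<in> H (lev k)" by metis
  have c: "coord (app (Q n) x) k = coord (app (Q (lev k)) x) k" if "k \<in> H n" for n k x
  proof -
    have *: "coord (app (Q n) x) k = coord (app (Q m) x) k" if "k \<in> H m" "m \<le> n" for m n
    proof -
      have "P m * Q n = P m * Q m" using compatD(1)[OF Q \<open>m \<le> n\<close>] compatD(1)[OF Q order_refl] by simp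
      then have "coord (app (P m * Q n) x) k = coord (app (P m * Q m) x) k" by simp
      then show ?thesis using that by simp
    qed
    show ?thesis
      using *[OF lev, of n] *[OF that, of "lev k"] by (metis nat_le_linear)
  qed
  define F where "F x = Abs_ell2 (\<lambda>k. coord (app (Q (lev k)) x) k)" for x
  have bd: "L2_set (\<lambda>k. cmod (coord (app (Q (lev k)) x) k)) G \<le> B * norm x" if "finite G" for G x
  proof -
    define N where "N = Max (lev ` G)"
    have "k \<in> H N" if "k \<in> G" for k
      using H_mono[of "lev k" N] lev[of k] \<open>finite G\<close> that by (auto simp: N_def)
    then have "L2_set (\<lambda>k. cmod (coord (app (Q (lev k)) x) k)) G
        = L2_set (\<lambda>k. cmod (coord (app (Q N) x) k)) G"
      by (intro L2_set_cong) (simp_all add: c)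
    also have "\<dots> \<le> norm (app (Q N) x)" by (rule L2_set_le_norm[OF that])
    also have "\<dots> \<le> B * norm x"
      by (rule order_trans[OF norm_app mult_right_mono[OF B]]) simp
    finally show ?thesis .
  qed
  have cF: "coord (F x) k = coord (app (Q (lev k)) x) k" for x k
    unfolding F_def by (subst coord_Abs_ell2[OF bd]) auto
  have nF: "norm (F x) \<le> B * norm x" for x
    unfolding F_def by (rule coord_Abs_ell2[OF bd])
  have "bounded_clinear F"
    unfolding bounded_clinear_def
    by (intro conjI allI bounded_linear_intro[of _ B] ell2_eqI)
      (use nF in \<open>simp_all add: cF plus_ell2.rep_eq scaleR_ell2.rep_eq scaleC.rep_eq algebra_simps\<close>)
  then obtain S where S: "app S = F" by (rule bounded_clinear_appE)
  have cS: "coord (app S x) k = coord (app (Q n) x) k" if "k \<in> H n" for n k x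
    by (simp add: S cF c[OF that])
  have QP: "P n * Q n = Q n * P n" for n by (rule compatD(1)[OF Q order_refl])
  have PS: "P n * S = Q n * P n" for n
    unfolding QP[symmetric] by (intro cop_eqI ell2_eqI) (simp add: cS)
  have "S * P n = Q n * P n" for n
  proof (rule cop_eq_by_proj)
    fix m
    have l: "P m * (S * P n) = Q m * (P m * P n)"
      by (simp add: PS mult.assoc[symmetric])
    show "P m * (S * P n) = P m * (Q n * P n)"
    proof (cases "m \<le> n")
      case True
      have "P m * (Q n * P n) = Q m * P m * P n"
        using compatD(1)[OF Q True] by (simp add: mult.assoc[symmetric])
      then show ?thesis by (simp add: l mult.assoc)
    next
      case False
      then have "n \<le> m" by simp
      have "P m * (Q n * P n) = P m * P n * Q n" by (simp add: QP[symmetric] mult.assoc)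
      then show ?thesis
        using compatD(2)[OF Q \<open>n \<le> m\<close>] by (simp add: l P_P(2)[OF \<open>n \<le> m\<close>] QP)
    qed
  qed
  moreover have "norm S \<le> B"
    by (rule norm_cop_bound) (use order_trans[OF norm_ge_zero B[of 0]] nF in \<open>simp_all add: S\<close>)
  ultimately show thesis using PS that by blast
qed

text \<open>The vectors \<open>P n x\<close> converge to \<open>x\<close>, and uniform boundedness
  extends strong convergence from them to \<open>x\<close> itself.\<close>

lemma strong_tendsto:
  assumes "\<forall>\<^sub>F h in F. norm (S h) \<le> B" and "\<And>n. ((\<lambda>h. app (S h) (app (P n) x)) \<longlongrightarrow> app (P n) x) F"
  shows "((\<lambda>h. app (S h) x) \<longlongrightarrow> x) F"
proof (rule tendstoI)
  fix e :: real assume e: "0 < e"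
  define \<delta> where "\<delta> = (e / 2) / (\<bar>B\<bar> + 1)"
  have "\<delta> > 0" using e by (simp add: \<delta>_def)
  then obtain n where n: "norm (app (P n) x - x) < \<delta>"
    using LIMSEQ_D[OF proj_tendsto, of \<delta> x] by blast
  have d: "\<bar>B\<bar> * \<delta> + \<delta> = e / 2"
  proof -
    have "\<bar>B\<bar> + 1 \<noteq> 0" using abs_ge_zero[of B] by linarith
    then have "(\<bar>B\<bar> + 1) * (e / 2) / (\<bar>B\<bar> + 1) = e / 2"
      by (rule nonzero_mult_div_cancel_left)
    then have "(\<bar>B\<bar> + 1) * \<delta> = e / 2" by (simp only: \<delta>_def times_divide_eq_right)
    then show ?thesis by (simp add: algebra_simps)
  qed
  have "\<forall>\<^sub>F h in F. dist (app (S h) (app (P n) x)) (app (P n) x) < e / 2"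
    using assms(2) e by (intro tendstoD) auto
  then show "\<forall>\<^sub>F h in F. dist (app (S h) x) x < e"
    using assms(1)
  proof eventually_elim
    case (elim h)
    have "norm (app (S h) (x - app (P n) x)) \<le> \<bar>B\<bar> * \<delta>"
      by (rule order_trans[OF norm_app mult_mono]) (use elim n in \<open>auto simp: norm_minus_commute\<close>)
    moreover have "norm (app (S h) x - x) \<le> norm (app (S h) (x - app (P n) x))
        + norm (app (S h) (app (P n) x) - app (P n) x) + norm (app (P n) x - x)"
      using norm_triangle_ineq[of "app (S h) (x - app (P n) x)" "app (S h) (app (P n) x) - app (P n) x"]
        norm_triangle_ineq[of "app (S h) x - app (P n) x" "app (P n) x - x"]
      by simp
    ultimately show ?case
      using elim(1) n d by (simp add: dist_norm)
  qed
qed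

lemma graphI:
  assumes "\<And>n. app (A n) x = app (P n) y" shows "x \<in> D" "L x = y"
  using assms graph[of x y] by blast+

lemma graphD: "x \<in> D \<Longrightarrow> app (A n) x = app (P n) (L x)"
  using graph[of x "L x"] by blast

lemma A_absorb: "m \<le> n \<Longrightarrow> P n * A m = A m" "m \<le> n \<Longrightarrow> A m * P n = A m"
  by (metis P_P(2) mult.assoc order_refl proj_A) (metis P_P(1) mult.assoc order_refl A_proj)

lemma graph_proj: "app (P m) x \<in> D" "L (app (P m) x) = app (A m) x"
proof -
  have "app (A n) (app (P m) x) = app (P n) (app (A m) x)" for n
  proof -
    have "A n * P m = P n * A m"
      by (cases "m \<le> n") (simp_all add: A_absorb A_proj proj_A)
    then show ?thesis by (metis app_simps(6))
  qed
  then show "app (P m) x \<in> D" "L (app (P m) x) = app (A m) x" by (rule graphI)+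
qed

section \<open>The group generated by \<open>L\<close>: existence and uniqueness\<close>

definition growth :: "real \<Rightarrow> real" where "growth t = exp (\<bar>t\<bar> * norm (A 0)) + C"

text \<open>Splitting along \<open>P 0\<close> leaves the exponential of the fixed bounded operator
  \<open>A 0\<close> and a remainder covered by \<open>off_zero\<close>. Neither depends on
  \<open>n\<close>, which is what gluing requires.\<close>

lemma norm_exp_A: "norm (exp (t *\<^sub>R A n)) \<le> growth t"
proof -
  have "P 0 * exp (t *\<^sub>R A 0) = exp (t *\<^sub>R A n) * P 0"
    by (rule exp_intertwine) (simp add: A_proj proj_A)
  then have "exp (t *\<^sub>R A n) = P 0 * exp (t *\<^sub>R A 0) + exp (t *\<^sub>R A n) * (1 - P 0)"
    by (simp add: right_diff_distrib)
  then have "norm (exp (t *\<^sub>R A n)) \<le> norm (P 0 * exp (t *\<^sub>R A 0)) + norm (exp (t *\<^sub>R A n) * (1 - P 0))"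
    using norm_triangle_ineq by metis
  moreover have "norm (P 0 * exp (t *\<^sub>R A 0)) \<le> norm (P 0) * norm (exp (t *\<^sub>R A 0))"
    by (rule norm_mult_ineq)
  moreover have "norm (P 0) * norm (exp (t *\<^sub>R A 0)) \<le> 1 * exp (norm (t *\<^sub>R A 0))"
    by (rule mult_mono[OF norm_proj_le norm_exp]) auto
  ultimately show ?thesis using off_zero[of t n] by (simp add: growth_def)
qed

lemma growth_mono: "\<bar>s\<bar> \<le> \<bar>t\<bar> \<Longrightarrow> growth s \<le> growth t"
  by (simp add: growth_def mult_right_mono)

text \<open>Each \<open>U t\<close> is chosen separately. No coherence in \<open>t\<close> has to be
  built in, because an operator is determined by its products with the \<open>P n\<close>.\<close>

definition U :: "real \<Rightarrow> 'a cop" where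
  "U t = (SOME S. \<forall>n. P n * S = exp (t *\<^sub>R A n) * P n \<and> S * P n = exp (t *\<^sub>R A n) * P n \<and> norm S \<le> growth t)"

lemma compat_exp: "compat Q \<Longrightarrow> compat (\<lambda>n. exp (Q n))"
  by (rule compat_transfer) (auto intro: exp_intertwine)

lemma compat_exp_mean: "compat Q \<Longrightarrow> compat (\<lambda>n. exp_mean (Q n))"
  by (rule compat_transfer) (auto intro: exp_mean_intertwine)

lemma U: "P n * U t = exp (t *\<^sub>R A n) * P n" "U t * P n = exp (t *\<^sub>R A n) * P n" "norm (U t) \<le> growth t"
proof -
  obtain S where S: "\<And>n. P n * S = exp (t *\<^sub>R A n) * P n" "\<And>n. S * P n = exp (t *\<^sub>R A n) * P n"
    "norm S \<le> growth t"
    using glue[OF compat_exp[OF compat_A(1)[of t]] norm_exp_A[of t]] by blast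
  show "P n * U t = exp (t *\<^sub>R A n) * P n" "U t * P n = exp (t *\<^sub>R A n) * P n" "norm (U t) \<le> growth t"
    using someI[of "\<lambda>S. \<forall>n. P n * S = exp (t *\<^sub>R A n) * P n \<and> S * P n = exp (t *\<^sub>R A n) * P n \<and> norm S \<le> growth t" S]
      S unfolding U_def[symmetric] by blast+
qed

lemma U_zero: "U 0 = 1"
  by (rule cop_eq_by_proj) (simp add: U)

lemma U_add: "U (s + t) = U s * U t"
proof (rule cop_eq_by_proj)
  fix n
  have "P n * (U s * U t) = exp (s *\<^sub>R A n) * exp (t *\<^sub>R A n) * P n"
    by (metis U(1) mult.assoc)
  also have "exp (s *\<^sub>R A n) * exp (t *\<^sub>R A n) = exp (s *\<^sub>R A n + t *\<^sub>R A n)"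
    by (rule exp_add_commuting[symmetric]) simp
  finally show "P n * U (s + t) = P n * (U s * U t)"
    by (simp add: U scaleR_add_left)
qed

lemma U_neg: "U t * U (- t) = 1" "U (- t) * U t = 1"
  using U_add[of t "- t"] U_add[of "- t" t] by (simp_all add: U_zero)

lemma U_tendsto: "((\<lambda>h. app (U h) x) \<longlongrightarrow> x) (at 0)"
proof (rule strong_tendsto)
  have "\<forall>\<^sub>F h in at 0. \<bar>h\<bar> \<le> (1::real)"
    by (auto simp: eventually_at dist_real_def intro!: exI[of _ 1])
  then show "\<forall>\<^sub>F h in at 0. norm (U h) \<le> growth 1"
  proof eventually_elim
    case (elim h)
    then show ?case using order_trans[OF U(3)[of h] growth_mono[of h 1]] by simp
  qed
  fix n
  have "((\<lambda>h. exp (h *\<^sub>R A n)) \<longlongrightarrow> exp (0 *\<^sub>R A n)) (at 0)"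
    using continuous_on_exp_scaleR[of UNIV "A n"] unfolding continuous_on_def by blast
  then have "((\<lambda>h. app (exp (h *\<^sub>R A n)) (app (P n) x))
      \<longlongrightarrow> app (exp (0 *\<^sub>R A n)) (app (P n) x)) (at 0)"
    by (rule bounded_bilinear.tendsto[OF bounded_bilinear_app _ tendsto_const])
  then show "((\<lambda>h. app (U h) (app (P n) x)) \<longlongrightarrow> app (P n) x) (at 0)"
    by (simp add: U(2) flip: app_simps(6))
qed

lemma U_continuous: "continuous_on UNIV (\<lambda>t. app (U t) x)"
proof (rule continuous_at_imp_continuous_on, rule ballI)
  fix t
  have "((\<lambda>h. app (U t) (app (U h) x)) \<longlongrightarrow> app (U t) x) (at 0)"
    by (rule bounded_linear.tendsto[OF bounded_linear_app U_tendsto])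
  then have "((\<lambda>h. app (U (t + h)) x) \<longlongrightarrow> app (U t) x) (at 0)"
    by (simp add: U_add)
  then show "isCont (\<lambda>t. app (U t) x) t"
    by (simp add: isCont_iff)
qed

lemma U_strongly_continuous: "strongly_continuous_group (\<lambda>t. app (U t))"
  unfolding strongly_continuous_group_def
  by (intro conjI allI bounded_clinear_app U_continuous) (auto simp: U_zero U_add fun_eq_iff)

lemma norm_exp_mean_A:
  assumes "\<bar>t\<bar> \<le> b" shows "norm (exp_mean (t *\<^sub>R A n)) \<le> growth b"
proof -
  have "norm (exp_mean (t *\<^sub>R A n) - 0) \<le> growth b"
  proof (rule norm_exp_mean_diff)
    fix s :: real assume "0 \<le> s" "s \<le> 1"
    then have "\<bar>s * t\<bar> \<le> \<bar>t\<bar>" by (simp add: abs_mult mult_left_le_one_le)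
    then have "\<bar>s * t\<bar> \<le> \<bar>b\<bar>" using assms by simp
    then show "norm (exp (s *\<^sub>R t *\<^sub>R A n) - 0) \<le> growth b"
      using norm_exp_A[of "s * t" n] growth_mono[of "s * t" b] by simp
  qed
  then show ?thesis by simp
qed

text \<open>Gluing \<open>exp_mean (h A n)\<close> over \<open>n\<close> gives bounded operators
  \<open>E h\<close> with \<open>U h x - x = h E h (L x)\<close> on the domain. The difference
  quotient is thus \<open>E h (L x)\<close>, and \<open>E h\<close> tends strongly to the
  identity.\<close>

lemma U_derivative:
  assumes "x \<in> D" shows "((\<lambda>t. app (U t) x) has_vector_derivative L x) (at 0)"
proof -
  have "\<exists>S. (\<forall>n. P n * S = exp_mean (h *\<^sub>R A n) * P n \<and> S * P n = exp_mean (h *\<^sub>R A n) * P n)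
      \<and> norm S \<le> growth h" for h
    by (rule glue[OF compat_exp_mean[OF compat_A(1)[of h]] norm_exp_mean_A[of h "\<bar>h\<bar>"]])
      (auto simp: growth_def)
  then obtain E where E: "\<And>h n. P n * E h = exp_mean (h *\<^sub>R A n) * P n"
    "\<And>h n. E h * P n = exp_mean (h *\<^sub>R A n) * P n" "\<And>h. norm (E h) \<le> growth h"
    by metis
  show ?thesis
  proof (rule has_vector_derivative_at_zeroI)
    fix h
    show "app (U h) x - app (U 0) x = h *\<^sub>R app (E h) (L x)"
    proof (rule eq_by_proj)
      fix n
      have "app (P n * (U h - U 0)) x = app ((exp (h *\<^sub>R A n) - 1) * P n) x"
        by (simp only: right_diff_distrib left_diff_distrib U_zero U(1)) simp
      also have "\<dots> = app (exp_mean (h *\<^sub>R A n) * (h *\<^sub>R (A n * P n))) x"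
        by (simp only: exp_mean_mult(2)[symmetric] mult.assoc mult_scaleR_left)
      also have "\<dots> = h *\<^sub>R app (exp_mean (h *\<^sub>R A n)) (app (A n) x)"
        by (simp add: A_proj)
      also have "\<dots> = h *\<^sub>R app (P n * E h) (L x)"
        by (simp add: graphD[OF assms] E)
      finally show "app (P n) (app (U h) x - app (U 0) x) = app (P n) (h *\<^sub>R app (E h) (L x))"
        by simp
    qed
  next
    show "((\<lambda>h. app (E h) (L x)) \<longlongrightarrow> L x) (at 0)"
    proof (rule strong_tendsto)
      have "\<forall>\<^sub>F h in at 0. \<bar>h\<bar> \<le> (1::real)"
        by (auto simp: eventually_at dist_real_def intro!: exI[of _ 1])
      then show "\<forall>\<^sub>F h in at 0. norm (E h) \<le> growth 1"
      proof eventually_elim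
        case (elim h)
        then show ?case using order_trans[OF E(3)[of h] growth_mono[of h 1]] by simp
      qed
      fix n
      have "((\<lambda>h. exp_mean (h *\<^sub>R A n) - 1) \<longlongrightarrow> 0) (at 0)"
      proof (rule Lim_null_comparison)
        show "\<forall>\<^sub>F h in at 0. norm (exp_mean (h *\<^sub>R A n) - 1)
            \<le> norm (h *\<^sub>R A n) * exp (norm (h *\<^sub>R A n))"
          by (simp add: norm_exp_mean_diff_one del: norm_scaleR)
        show "((\<lambda>h. norm (h *\<^sub>R A n) * exp (norm (h *\<^sub>R A n))) \<longlongrightarrow> 0) (at 0)"
          by (rule tendsto_eq_intros refl | simp)+
      qed
      then have "((\<lambda>h. exp_mean (h *\<^sub>R A n)) \<longlongrightarrow> 1) (at 0)" by (simp add: LIM_zero_iff)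
      then have "((\<lambda>h. app (exp_mean (h *\<^sub>R A n)) (app (P n) (L x)))
          \<longlongrightarrow> app 1 (app (P n) (L x))) (at 0)"
        by (rule bounded_bilinear.tendsto[OF bounded_bilinear_app _ tendsto_const])
      then show "((\<lambda>h. app (E h) (app (P n) (L x))) \<longlongrightarrow> app (P n) (L x)) (at 0)"
        by (simp add: E(2) flip: app_simps(6))
    qed
  qed
qed

text \<open>For the converse, a derivative \<open>y\<close> of the orbit of \<open>x\<close> is
  projected to each piece, where the group is an exponential of a bounded operator and
  \<open>y\<close> must agree with \<open>A n x\<close>. By \<open>graph\<close> this places
  \<open>x\<close> in the domain.\<close>

lemma U_generates: "generates_group D L (\<lambda>t. app (U t))"
  unfolding generates_group_def
proof (intro conjI allI iffI U_strongly_continuous)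
  fix x y
  assume "x \<in> D \<and> L x = y"
  then show "((\<lambda>t. app (U t) x) has_vector_derivative y) (at 0)" using U_derivative by blast
next
  fix x y
  assume y: "((\<lambda>t. app (U t) x) has_vector_derivative y) (at 0)"
  have "app (A n) x = app (P n) y" for n
  proof -
    have "((\<lambda>t. app (P n * U t) x) has_vector_derivative app (P n) y) (at 0)"
      using bounded_linear.has_vector_derivative[OF bounded_linear_app y] by simp
    then have "((\<lambda>t. app (exp (t *\<^sub>R A n)) (app (P n) x)) has_vector_derivative app (P n) y) (at 0)"
      by (simp add: U)
    then have "app (P n) y = app (A n * exp (0 *\<^sub>R A n)) (app (P n) x)"
      using app_exp_derivative vector_derivative_unique_at by blast
    then have "app (P n) y = app (A n * P n) x" by simp
    then show ?thesis by (simp only: A_proj[OF order_refl])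
  qed
  then show "x \<in> D" "L x = y" by (rule graphI)+
qed

text \<open>For \<open>x\<close> in the domain, \<open>exp (- t A n) P n (V t x)\<close> has
  derivative zero in \<open>t\<close>, so \<open>V\<close> and \<open>U\<close> agree there. The
  domain is dense, since it contains every \<open>P n x\<close>.\<close>

lemma generates_unique:
  assumes "generates_group D L V" shows "V t = app (U t)"
proof -
  have V: "bounded_clinear (V t)" "V 0 = id" "V (s + t) = V s \<circ> V t" for s t
    using assms unfolding generates_group_def strongly_continuous_group_def by auto
  have Vlin: "bounded_linear (V t)" for t
    using V(1) unfolding bounded_clinear_def by blast
  have gen: "x \<in> D \<and> L x = y \<longleftrightarrow> ((\<lambda>t. V t x) has_vector_derivative y) (at 0)" for x y
    using assms unfolding generates_group_def by blast
  have VD: "V s x \<in> D \<and> L (V s x) = V s (L x)" if "x \<in> D" for s x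
  proof -
    have "((\<lambda>t. V t x) has_vector_derivative L x) (at 0)" using gen that by blast
    then have "((\<lambda>t. V s (V t x)) has_vector_derivative V s (L x)) (at 0)"
      by (rule bounded_linear.has_vector_derivative[OF Vlin])
    moreover have "V s (V t x) = V t (V s x)" for t
      using V(3)[of s t] V(3)[of t s] by (simp add: fun_eq_iff add.commute)
    ultimately show ?thesis using gen by simp
  qed
  have Vder: "((\<lambda>t. V t x) has_vector_derivative V s (L x)) (at s)" if "x \<in> D" for s x
  proof -
    have "((\<lambda>t. V t (V s x)) has_vector_derivative V s (L x)) (at (s - s))"
      using gen VD[OF that] by simp
    moreover have "((\<lambda>t. t - s) has_vector_derivative 1) (at s)"
      by (auto intro!: derivative_eq_intros)
    ultimately have "((\<lambda>t. V t (V s x)) \<circ> (\<lambda>t. t - s) has_vector_derivative 1 *\<^sub>R V s (L x)) (at s)"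
      by (intro vector_diff_chain_at) auto
    moreover have "V (t - s) (V s x) = V t x" for t
      using V(3)[of "t - s" s] by (simp add: fun_eq_iff)
    ultimately show ?thesis by (simp add: o_def)
  qed
  have core: "app (P n) (V t x) = app (P n) (app (U t) x)" if "x \<in> D" for n x t
  proof -
    define f where "f t = app (exp (t *\<^sub>R (- A n))) (app (P n) (V t x))" for t
    have "(f has_vector_derivative 0) (at s)" for s
    proof -
      have "((\<lambda>t. exp (t *\<^sub>R (- A n))) has_vector_derivative exp (s *\<^sub>R (- A n)) * (- A n)) (at s)"
        by (rule exp_scaleR_has_vector_derivative_right)
      moreover have "((\<lambda>t. app (P n) (V t x)) has_vector_derivative app (P n) (V s (L x))) (at s)"
        by (rule bounded_linear.has_vector_derivative[OF bounded_linear_app Vder[OF that]])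
      ultimately have "(f has_vector_derivative app (exp (s *\<^sub>R (- A n))) (app (P n) (V s (L x)))
          + app (exp (s *\<^sub>R (- A n)) * (- A n)) (app (P n) (V s x))) (at s)"
        unfolding f_def by (rule bounded_bilinear.has_vector_derivative[OF bounded_bilinear_app])
      moreover have "app (P n) (V s (L x)) = app (A n) (app (P n) (V s x))"
        using VD[OF that, of s] graphD[of "V s x" n] A_proj[OF order_refl, of n]
        by (metis app_simps(6))
      ultimately show ?thesis by simp
    qed
    then have "f t = f 0"
      using has_vector_derivative_zero_constant[of UNIV f] by (metis UNIV_I convex_UNIV)
    then have "app (exp (t *\<^sub>R (- A n))) (app (P n) (V t x)) = app (P n) x"
      by (simp add: f_def V(2))
    then have "app (exp (t *\<^sub>R A n) * exp (t *\<^sub>R (- A n))) (app (P n) (V t x)) = app (exp (t *\<^sub>R A n) * P n) x"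
      by simp
    moreover have "exp (t *\<^sub>R A n) * exp (t *\<^sub>R (- A n)) = 1"
      using exp_minus_inverse[of "t *\<^sub>R A n"] by simp
    ultimately have "app 1 (app (P n) (V t x)) = app (P n * U t) x" by (simp only: U(1))
    then show ?thesis by simp
  qed
  have onD: "V t x = app (U t) x" if "x \<in> D" for x
    by (rule eq_by_proj) (rule core[OF that])
  show ?thesis
  proof
    fix x
    have "(\<lambda>n. V t (app (P n) x)) \<longlonglongrightarrow> V t x"
      by (rule bounded_linear.tendsto[OF Vlin proj_tendsto])
    moreover have "(\<lambda>n. V t (app (P n) x)) \<longlonglongrightarrow> app (U t) x"
      unfolding onD[OF graph_proj(1)] by (rule bounded_linear.tendsto[OF bounded_linear_app proj_tendsto])
    ultimately show "V t x = app (U t) x" by (rule LIMSEQ_unique)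
  qed
qed

text \<open>
  The family \<open>exp_mean (t (A n - \<lambda>))\<close> glues to a bounded operator, the analogue of
  \<open>(1/t) \<integral>\<^sub>0\<^sup>t exp (- \<lambda> s) T(s) ds\<close>; composed with the inverse of
  \<open>exp (t \<lambda>) - T(t)\<close> it gives the resolvent at \<open>\<lambda>\<close>.
\<close>

lemma spectral_inclusion:
  assumes inv: "invertible_elem (scalar_op (exp (of_real t * lam)) - U t)" and "t \<noteq> 0"
  shows "lam \<in> resolvent_set D L"
proof -
  define z where "z = exp (of_real t * lam)"
  have "z \<noteq> 0" by (simp add: z_def)
  define B where "B n = t *\<^sub>R (A n - scalar_op lam)" for n
  have exp_B: "exp (s *\<^sub>R B n) = scalar_op (exp (of_real (- s * t) * lam)) * exp ((s * t) *\<^sub>R A n)" for s n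
  proof -
    have "s *\<^sub>R B n = scalar_op (of_real (- s * t) * lam) + (s * t) *\<^sub>R A n"
      by (rule cop_eqI) (simp add: B_def scaleR_diff_right scaleR_scaleC)
    moreover have "exp (scalar_op (of_real (- s * t) * lam) + (s * t) *\<^sub>R A n)
        = exp (scalar_op (of_real (- s * t) * lam)) * exp ((s * t) *\<^sub>R A n)"
      by (rule exp_add_commuting) (simp add: scalar_op_commute[of "A n"])
    ultimately show ?thesis by (simp add: scalar_op_exp)
  qed
  have "norm (exp_mean (B n) - 0) \<le> exp (\<bar>t\<bar> * cmod lam) * growth t" for n
  proof (rule norm_exp_mean_diff)
    fix s :: real assume s: "0 \<le> s" "s \<le> 1"
    then have st: "\<bar>s * t\<bar> \<le> \<bar>t\<bar>" by (simp add: abs_mult mult_left_le_one_le)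
    have "Re (of_real (- s * t) * lam) \<le> \<bar>s * t\<bar> * cmod lam"
      using complex_Re_le_cmod[of "of_real (- s * t) * lam"] by (simp add: norm_mult abs_mult)
    also have "\<dots> \<le> \<bar>t\<bar> * cmod lam" using st by (intro mult_right_mono) auto
    finally have "cmod (exp (of_real (- s * t) * lam)) \<le> exp (\<bar>t\<bar> * cmod lam)" by simp
    moreover have "norm (exp ((s * t) *\<^sub>R A n)) \<le> growth t"
      using norm_exp_A growth_mono[OF st] order_trans by blast
    ultimately have "norm (scalar_op (exp (of_real (- s * t) * lam)) :: 'a cop) * norm (exp ((s * t) *\<^sub>R A n))
        \<le> exp (\<bar>t\<bar> * cmod lam) * growth t"
      by (intro mult_mono) auto
    then show "norm (exp (s *\<^sub>R B n) - 0) \<le> exp (\<bar>t\<bar> * cmod lam) * growth t"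
      unfolding exp_B diff_zero by (rule order_trans[OF norm_mult_ineq])
  qed
  then have bound: "norm (exp_mean (B n)) \<le> exp (\<bar>t\<bar> * cmod lam) * growth t" for n by simp
  have "compat B" using compat_A(2)[of t lam] by (simp add: B_def[abs_def])
  then obtain E where E: "\<And>n. P n * E = exp_mean (B n) * P n"
    using glue[OF compat_exp_mean[OF \<open>compat B\<close>] bound] by blast
  obtain J where J: "(scalar_op z - U t) * J = 1" "J * (scalar_op z - U t) = 1"
    using inv unfolding invertible_elem_def z_def by blast
  \<comment> \<open>The factor \<open>t z\<close> comes from
    \<open>t (lam - A n) exp_mean (B n) = 1 - exp (B n)\<close> together with
    \<open>z exp (B n) = exp (t A n)\<close>: on each piece \<open>lam - A n\<close> takes
    \<open>t z E\<close> to \<open>z - U t\<close>, and \<open>J\<close> removes this.\<close>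
  define R where "R = scalar_op (of_real t * z) * E * J"
  have z_exp_B: "scalar_op z * exp (B n) = exp (t *\<^sub>R A n)" for n
    using exp_B[of 1 n] by (simp add: z_def mult.assoc[symmetric] scalar_op_simps(2)[symmetric] exp_add[symmetric] scalar_op_simps(3))
  have tB: "t *\<^sub>R (scalar_op lam - A n) = - B n" for n by (simp add: B_def algebra_simps)
  have solve: "(scalar_op lam - A n) * (P n * R) = P n" for n
  proof -
    have "(scalar_op lam - A n) * (P n * R)
        = (scalar_op lam - A n) * (scalar_op (of_real t * z) * (P n * E)) * J"
      by (simp add: R_def mult.assoc scalar_op_commute[of "P n", symmetric] flip: mult.assoc)
    also have "\<dots> = scalar_op z * (t *\<^sub>R (scalar_op lam - A n) * exp_mean (B n)) * P n * J"
      by (simp add: E scalar_op_simps(2,5) mult.assoc)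
        (simp add: scalar_op_commute[of "scalar_op lam - A n"] flip: mult.assoc)
    also have "\<dots> = scalar_op z * (1 - exp (B n)) * P n * J"
      unfolding tB by (simp add: exp_mean_mult)
    also have "\<dots> = P n * (scalar_op z - U t) * J"
      by (simp add: right_diff_distrib left_diff_distrib z_exp_B U(1) scalar_op_commute)
    also have "\<dots> = P n" by (simp add: mult.assoc J)
    finally show ?thesis .
  qed
  have R: "app R y \<in> D" "L (app R y) = lam *\<^sub>C app R y - y" for y
  proof -
    have "app (A n) (app R y) = app (P n) (lam *\<^sub>C app R y - y)" for n
    proof -
      have "app (A n) (app R y) = app (A n) (app (P n) (app R y))"
        by (metis A_proj app_simps(6) order_refl)
      then show ?thesis using arg_cong[OF solve[of n], of "\<lambda>S. app S y"] by (simp add: algebra_simps)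
    qed
    then show "app R y \<in> D" "L (app R y) = lam *\<^sub>C app R y - y" by (rule graphI)+
  qed
  \<comment> \<open>The left inverse is obtained without commuting \<open>R\<close> with
    \<open>L\<close>. The defect \<open>v\<close> is annihilated by \<open>lam - L\<close>, hence
    fixed by every \<open>exp (B n)\<close>, hence satisfies \<open>U t v = z v\<close>; injectivity
    of \<open>z - U t\<close> forces \<open>v = 0\<close>.\<close>
  have "app R (lam *\<^sub>C x - L x) = x" if "x \<in> D" for x
  proof -
    define y where "y = lam *\<^sub>C x - L x"
    define v where "v = app R y - x"
    have Py: "app (P n) y = lam *\<^sub>C app (P n) x - app (A n) x" for n
      by (simp add: y_def graphD[OF that])
    have Av: "app (A n) v = lam *\<^sub>C app (P n) v" for n
      using graphD[OF R(1), of n y]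
      by (simp add: v_def R(2) scaleC_diff_right Py del: scaleC_scaleC)
    have "app (U t) v = z *\<^sub>C v"
    proof (rule eq_by_proj)
      fix n
      have "app (A n) (app (P n) v) = lam *\<^sub>C app (P n) v"
        by (metis Av A_proj app_simps(6) order_refl)
      then have "app (B n) (app (P n) v) = 0" by (simp add: B_def)
      then have "app (exp (B n) - 1) (app (P n) v) = 0"
        by (simp only: exp_mean_mult(2)[symmetric] app_simps(6) app_right_simps)
      then have "app (scalar_op z * exp (B n)) (app (P n) v) = z *\<^sub>C app (P n) v" by simp
      then have "app (P n * U t) v = z *\<^sub>C app (P n) v" by (simp add: z_exp_B U(1))
      then show "app (P n) (app (U t) v) = app (P n) (z *\<^sub>C v)" by simp
    qed
    then have "app (J * (scalar_op z - U t)) v = 0" by simp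
    then have "v = 0" by (simp add: J)
    then show ?thesis by (simp add: v_def y_def)
  qed
  then show ?thesis
    unfolding resolvent_set_def using R bounded_clinear_app[of R] by auto
qed

text \<open>The resolvent of \<open>L\<close> maps the range of \<open>P 0\<close> into itself and
  inverts \<open>z - A 0\<close> there. Off \<open>H 0\<close> the operator \<open>A 0\<close>
  vanishes, so \<open>z - A 0\<close> is multiplication by the nonzero number \<open>z\<close>. The
  inverse \<open>G\<close> combines the two blocks.\<close>

lemma resolvent_base:
  assumes "z \<in> resolvent_set D L" "z \<noteq> 0"
  shows "invertible_elem (scalar_op z - A 0)"
proof -
  obtain F where F: "bounded_clinear F" "\<And>y. F y \<in> D" "\<And>y. z *\<^sub>C F y - L (F y) = y"
    "\<And>x. x \<in> D \<Longrightarrow> F (z *\<^sub>C x - L x) = x"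
    using assms(1) unfolding resolvent_set_def by blast
  obtain R where R: "app R = F" by (rule bounded_clinear_appE[OF F(1)])
  define G where "G = R * P 0 + scalar_op (1 / z) * (1 - P 0)"
  have AP: "app (A 0) (app (P 0) x) = app (A 0) x" "app (P 0) (app (A 0) x) = app (A 0) x" for x
    by (metis A_proj app_simps(6) order_refl) (metis proj_A app_simps(6) order_refl)
  have PP: "app (P 0) (app (P 0) x) = app (P 0) x" for x
    by (metis P_P(3) app_simps(6))
  have "(scalar_op z - A 0) * G = 1"
  proof (rule cop_eqI)
    fix x
    define v where "v = F (app (P 0) x)"
    have v: "v \<in> D" "z *\<^sub>C v - L v = app (P 0) x" using F by (auto simp: v_def)
    have A0v: "app (A 0) v = z *\<^sub>C app (P 0) v - app (P 0) x"
    proof -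
      have "L v = z *\<^sub>C v - app (P 0) x" using v(2) by (simp add: algebra_simps)
      then show ?thesis using graphD[OF v(1), of 0] by (simp add: PP)
    qed
    \<comment> \<open>Both \<open>v\<close> and \<open>P 0 v\<close> solve the resolvent equation
      with right-hand side \<open>P 0 x\<close>, so uniqueness shows that \<open>v\<close> stays in
      the range of \<open>P 0\<close>.\<close>
    have "app (P 0) v = F (z *\<^sub>C app (P 0) v - L (app (P 0) v))"
      using F(4)[OF graph_proj(1)] by simp
    also have "\<dots> = F (app (P 0) x)" by (simp add: graph_proj A0v)
    also have "\<dots> = v" by (simp add: v_def)
    finally have Pv: "app (P 0) v = v" .
    have "app ((scalar_op z - A 0) * G) x = z *\<^sub>C v + z *\<^sub>C (1 / z) *\<^sub>C (x - app (P 0) x) - app (A 0) v"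
      using \<open>z \<noteq> 0\<close> by (simp add: G_def R v_def scaleC_add_right scaleC_diff_right AP)
    then show "app ((scalar_op z - A 0) * G) x = app 1 x"
      using \<open>z \<noteq> 0\<close> by (simp add: A0v Pv)
  qed
  moreover have "G * (scalar_op z - A 0) = 1"
  proof (rule cop_eqI)
    fix x
    have "app R (z *\<^sub>C app (P 0) x - app (A 0) x) = app (P 0) x"
      unfolding R using F(4)[OF graph_proj(1)[of 0 x]] by (simp add: graph_proj)
    moreover have "app (1 - P 0) (z *\<^sub>C x - app (A 0) x) = z *\<^sub>C (x - app (P 0) x)"
      by (simp add: AP scaleC_diff_right)
    moreover have "app (G * (scalar_op z - A 0)) x
        = app R (z *\<^sub>C app (P 0) x - app (A 0) x) + (1 / z) *\<^sub>C app (1 - P 0) (z *\<^sub>C x - app (A 0) x)"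
      by (simp add: G_def AP scaleC_add_right scaleC_diff_right)
    ultimately have "app (G * (scalar_op z - A 0)) x
        = app (P 0) x + (1 / z) *\<^sub>C z *\<^sub>C (x - app (P 0) x)" by (simp only:)
    then show "app (G * (scalar_op z - A 0)) x = app 1 x"
      using \<open>z \<noteq> 0\<close> by simp
  qed
  ultimately show ?thesis unfolding invertible_elem_def by blast
qed

section \<open>Inverting \<open>\<mu> - U t\<close> away from the unit circle\<close>

definition Q :: "'a cop" where "Q = 1 - P 0"

lemma Q: "Q * Q = Q" "U s * Q = Q * U s" "P 0 * Q = 0" "Q * P 0 = 0"
  by (simp_all add: Q_def left_diff_distrib right_diff_distrib P_P U)

lemma Q_Q: "app Q (app Q x) = app Q x"
  by (metis Q(1) app_simps(6))

lemma U_Q: "app (U s) (app Q x) = app Q (app (U s) x)"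
  by (metis Q(2) app_simps(6))

lemma norm_U_Q: "norm (U s * Q) \<le> C"
proof (rule norm_cop_bound)
  show C: "0 \<le> C" using off_zero norm_ge_zero order_trans by blast
  fix x
  have "norm (app (P n) (app (U s * Q) x)) \<le> C * norm x" for n
  proof -
    have "P n * (U s * Q) = exp (s *\<^sub>R A n) * Q * P n"
    proof -
      have "P n * Q = Q * P n" by (simp add: Q_def left_diff_distrib right_diff_distrib P_P)
      then show ?thesis by (metis U(1) mult.assoc)
    qed
    then have "app (P n) (app (U s * Q) x) = app (exp (s *\<^sub>R A n) * Q) (app (P n) x)"
      by (metis app_simps(6))
    moreover have "norm (app (exp (s *\<^sub>R A n) * Q) (app (P n) x)) \<le> C * norm x"
      by (rule order_trans[OF norm_app mult_mono]) (use off_zero C norm_proj in \<open>auto simp: Q_def\<close>)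
    ultimately show ?thesis by simp
  qed
  then show "norm (app (U s * Q) x) \<le> C * norm x"
    using tendsto_norm[OF proj_tendsto[of "app (U s * Q) x"]]
    by (intro tendsto_upperbound[of "\<lambda>n. norm (app (P n) (app (U s * Q) x))"]) auto
qed

text \<open>Since \<open>Q\<close> is a projection commuting with the group, the powers of
  \<open>U s * Q\<close> are again of the form \<open>U (n s) * Q\<close>. They are all bounded by
  \<open>C\<close>, even if \<open>C > 1\<close>, and the factor \<open>c ^ n\<close> makes the
  series converge.\<close>

lemma invertible_off_zero:
  assumes "cmod c < 1" shows "invertible_elem (1 - scalar_op c * (U s * Q))"
proof (rule neumann_series)
  have pow: "(U s * Q) ^ Suc n = U (real (Suc n) * s) * Q" for n
  proof (induction n)
    case (Suc n)
    have "(U s * Q) ^ Suc (Suc n) = U s * (Q * U (real (Suc n) * s)) * Q"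
      by (simp only: power_Suc[of _ "Suc n"] Suc mult.assoc)
    also have "\<dots> = U s * U (real (Suc n) * s) * (Q * Q)"
      by (simp only: Q(2)[symmetric] mult.assoc)
    also have "\<dots> = U (real (Suc (Suc n)) * s) * Q"
      by (simp add: Q U_add[symmetric] algebra_simps)
    finally show ?case .
  qed simp
  have sc: "(scalar_op c * S) ^ n = scalar_op (c ^ n) * S ^ n" for S :: "'a cop" and n
    by (induction n) (simp_all add: scalar_op_simps(2,3) mult.assoc, simp add: scalar_op_commute[of S] flip: mult.assoc)
  have bound: "norm ((U s * Q) ^ n) \<le> max 1 C" for n
    by (cases n) (use norm_U_Q in \<open>auto simp only: pow power_0 norm_one max.coboundedI1 max.coboundedI2 order_refl\<close>)
  show "summable (\<lambda>n. (scalar_op c * (U s * Q)) ^ n)"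
  proof (rule summable_comparison_test, intro exI allI impI)
    fix n
    have "norm (scalar_op (c ^ n) * (U s * Q) ^ n) \<le> norm (scalar_op (c ^ n) :: 'a cop) * norm ((U s * Q) ^ n)"
      by (rule norm_mult_ineq)
    also have "\<dots> \<le> cmod c ^ n * max 1 C"
      by (rule mult_mono) (use bound in \<open>auto simp: norm_power\<close>)
    finally show "norm ((scalar_op c * (U s * Q)) ^ n) \<le> cmod c ^ n * max 1 C"
      by (simp add: sc)
    show "summable (\<lambda>n. cmod c ^ n * max 1 C)"
      using assms by (intro summable_mult2 summable_geometric) simp
  qed
qed

text \<open>Outside the circle \<mu> is factored out, leaving a series in
  \<open>U t / \<mu>\<close>; inside it \<open>- U t\<close> is factored out, leaving a series in
  \<open>\<mu> U (- t)\<close>. The second case is where boundedness for the opposite time direction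
  enters. Each identity carries a factor \<open>Q\<close> because the series only sees that
  block.\<close>

lemma inverse_off_zero:
  assumes "\<mu> \<noteq> 0" "cmod \<mu> \<noteq> 1"
  obtains J where "J * (scalar_op \<mu> - U t) * Q = Q" "(scalar_op \<mu> - U t) * J * Q = Q"
proof (cases "cmod \<mu> > 1")
  case True
  define X where "X = 1 - scalar_op (1 / \<mu>) * (U t * Q)"
  have "invertible_elem X" unfolding X_def
    by (rule invertible_off_zero) (use True in \<open>simp add: norm_divide divide_less_eq\<close>)
  then obtain Y where Y: "X * Y = 1" "Y * X = 1" unfolding invertible_elem_def by blast
  have XQ: "(scalar_op \<mu> - U t) * Q = scalar_op \<mu> * X * Q"
    using \<open>\<mu> \<noteq> 0\<close> by (intro cop_eqI) (simp add: X_def scaleC_diff_right Q_Q)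
  have QX: "Q * X = X * Q"
    by (rule cop_eqI) (simp add: X_def Q_Q U_Q)
  have QY: "Q * Y = Y * Q"
  proof -
    have "Y * (Q * X) * Y = Y * (X * Q) * Y" by (simp add: QX)
    then show ?thesis by (metis Y mult.assoc mult_1_left mult_1_right)
  qed
  have "scalar_op (1 / \<mu>) * Y * (scalar_op \<mu> - U t) * Q = scalar_op (1 / \<mu>) * Y * (scalar_op \<mu> * X * Q)"
    by (simp add: XQ mult.assoc)
  also have "\<dots> = (scalar_op (1 / \<mu>) * scalar_op \<mu>) * (Y * X) * Q"
    by (metis mult.assoc scalar_op_commute)
  also have "\<dots> = Q" using \<open>\<mu> \<noteq> 0\<close> by (simp add: Y scalar_op_simps(3) flip: scalar_op_simps(2))
  finally have 1: "scalar_op (1 / \<mu>) * Y * (scalar_op \<mu> - U t) * Q = Q" .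
  have "(scalar_op \<mu> - U t) * (scalar_op (1 / \<mu>) * Y) * Q = ((scalar_op \<mu> - U t) * Q) * scalar_op (1 / \<mu>) * Y"
    by (metis QY mult.assoc scalar_op_commute)
  also have "\<dots> = scalar_op \<mu> * scalar_op (1 / \<mu>) * (X * Y) * Q"
    unfolding XQ by (metis QY mult.assoc scalar_op_commute)
  also have "\<dots> = Q" using \<open>\<mu> \<noteq> 0\<close> by (simp add: Y scalar_op_simps(3) flip: scalar_op_simps(2))
  finally show thesis using 1 that by blast
next
  case False
  then have less: "cmod \<mu> < 1" using assms by simp
  define X where "X = 1 - scalar_op \<mu> * (U (- t) * Q)"
  have "invertible_elem X" unfolding X_def by (rule invertible_off_zero[OF less])
  then obtain Y where Y: "X * Y = 1" "Y * X = 1" unfolding invertible_elem_def by blast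
  have UU: "app (U t) (app (U (- t)) x) = x" "app (U (- t)) (app (U t) x) = x" for x
    using U_neg[of t] by (metis app_simps(2,6))+
  have XQ: "(scalar_op \<mu> - U t) * Q = - U t * X * Q"
    by (rule cop_eqI) (simp add: X_def Q_Q UU)
  have XQ': "X * U (- t) * (scalar_op \<mu> - U t) * Q = X * - X * Q"
    by (rule cop_eqI) (simp add: X_def Q_Q UU)
  have QX: "Q * X = X * Q"
    by (rule cop_eqI) (simp add: X_def Q_Q U_Q)
  have QY: "Q * Y = Y * Q"
  proof -
    have "Y * (Q * X) * Y = Y * (X * Q) * Y" by (simp add: QX)
    then show ?thesis by (metis Y mult.assoc mult_1_left mult_1_right)
  qed
  define J where "J = - (Y * U (- t))"
  have "J * (scalar_op \<mu> - U t) * Q = J * (- U t * X * Q)" by (simp only: mult.assoc XQ)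
  also have "\<dots> = Y * (U (- t) * U t) * X * Q" by (simp add: J_def mult.assoc)
  also have "\<dots> = Q" by (simp add: U_neg Y)
  finally have 1: "J * (scalar_op \<mu> - U t) * Q = Q" .
  have UX: "U (- t) * X = X * U (- t)"
    by (rule cop_eqI) (simp add: X_def U_Q)
  have UY: "U (- t) * Y = Y * U (- t)"
  proof -
    have "Y * (U (- t) * X) * Y = Y * (X * U (- t)) * Y" by (simp add: UX)
    then show ?thesis by (metis Y mult.assoc mult_1_left mult_1_right)
  qed
  have JQ: "J * Q = Q * J" by (simp add: J_def mult.assoc Q QY UY flip: UY) (metis QY Q(2) mult.assoc UY)
  have "(scalar_op \<mu> - U t) * J * Q = (- U t * X * Q) * J"
    by (metis JQ XQ mult.assoc)
  also have "\<dots> = - U t * X * J * Q" by (simp add: mult.assoc JQ)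
  also have "\<dots> = U t * (X * Y) * U (- t) * Q" by (simp add: J_def mult.assoc)
  also have "\<dots> = Q" by (simp add: Y U_neg)
  finally show thesis using 1 that by blast
qed

text \<open>Relative to \<open>P 0\<close> and \<open>Q\<close> the operator \<open>U t\<close> is
  block diagonal: the first block is that of \<open>exp (t A 0)\<close>, the second is power bounded
  in both time directions. The two block inverses are added.\<close>

lemma invertible_U:
  assumes "t \<noteq> 0" "\<mu> \<noteq> 0" "cmod \<mu> \<noteq> 1"
    and res: "\<And>z. exp (of_real t * z) = \<mu> \<Longrightarrow> z \<in> resolvent_set D L"
  shows "invertible_elem (scalar_op \<mu> - U t)"
proof -
  define B where "B = scalar_op \<mu> - U t"
  define E where "E = scalar_op \<mu> - exp (t *\<^sub>R A 0)"
  have "invertible_elem E"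
    unfolding E_def
  proof (rule invertible_exp[OF assms(1,2)])
    fix z assume z: "exp (of_real t * z) = \<mu>"
    \<comment> \<open>At \<open>z = 0\<close> the exponential would be 1, which has modulus
      1.\<close>
    then have "z \<noteq> 0" using assms(3) by auto
    then show "invertible_elem (scalar_op z - A 0)" by (rule resolvent_base[OF res[OF z]])
  qed
  then obtain J1 where J1: "E * J1 = 1" "J1 * E = 1" unfolding invertible_elem_def by blast
  obtain J2 where J2: "J2 * B * Q = Q" "B * J2 * Q = Q"
    using inverse_off_zero[OF assms(2,3)] unfolding B_def by blast
  have BP: "B * P 0 = E * P 0" "P 0 * B = E * P 0"
    by (simp_all add: B_def E_def left_diff_distrib right_diff_distrib U scalar_op_commute)
  have EP: "E * P 0 = P 0 * E"
    by (simp add: E_def left_diff_distrib right_diff_distrib scalar_op_commute[of "P 0"])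
      (metis U(1,2) P_P(3) compatD(1)[OF compat_exp[OF compat_A(1)] order_refl])
  have JP: "J1 * P 0 = P 0 * J1"
  proof -
    have "J1 * (E * P 0) * J1 = J1 * (P 0 * E) * J1" by (simp add: EP)
    then show ?thesis by (metis J1 mult.assoc mult_1_left mult_1_right)
  qed
  define G where "G = J1 * P 0 + J2 * Q"
  have QB: "Q * B = B * Q"
    by (simp add: Q_def left_diff_distrib right_diff_distrib BP)
  have "G * B = J1 * (P 0 * B) + J2 * (Q * B)"
    by (simp add: G_def distrib_right mult.assoc)
  also have "\<dots> = J1 * E * P 0 + J2 * B * Q" by (simp add: BP QB mult.assoc)
  also have "\<dots> = 1" by (simp add: J1 J2) (simp add: Q_def)
  finally have 1: "G * B = 1" .
  have "B * G = B * P 0 * J1 + B * J2 * Q"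
    by (simp add: G_def distrib_left mult.assoc JP)
  also have "\<dots> = P 0 * (E * J1) + Q" by (simp add: BP J2 mult.assoc[symmetric]) (simp add: EP)
  also have "\<dots> = 1" by (simp add: J1) (simp add: Q_def)
  finally show ?thesis using 1 unfolding invertible_elem_def B_def by blast
qed

theorem spectral_mapping:
  assumes gen: "generates_group D L V" and "t \<noteq> 0"
    and axis: "\<And>\<tau>. \<i> * of_real \<tau> \<in> spectrum D L"
  shows "spectrum UNIV (V t) = (\<lambda>z. exp (of_real t * z)) ` spectrum D L"
proof (intro set_eqI iffI)
  fix \<mu> assume "\<mu> \<in> spectrum UNIV (V t)"
  then have ni: "\<not> invertible_elem (scalar_op \<mu> - U t)"
    by (simp add: generates_unique[OF gen] spectrum_def resolvent_set_app)
  have "\<mu> \<noteq> 0"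
  proof
    assume "\<mu> = 0"
    then have "(scalar_op \<mu> - U t) * (- U (- t)) = 1" "(- U (- t)) * (scalar_op \<mu> - U t) = 1"
      by (simp_all add: scalar_op_simps(4) U_neg)
    then show False using ni unfolding invertible_elem_def by blast
  qed
  show "\<mu> \<in> (\<lambda>z. exp (of_real t * z)) ` spectrum D L"
  proof (cases "cmod \<mu> = 1")
    case True
    define \<theta> where "\<theta> = Arg \<mu>"
    have "\<mu> = exp (\<i> * of_real \<theta>)"
      using Arg_eq[OF \<open>\<mu> \<noteq> 0\<close>] True by (simp add: \<theta>_def)
    then have "\<mu> = exp (of_real t * (\<i> * of_real (\<theta> / t)))" using \<open>t \<noteq> 0\<close> by simp
    then show ?thesis using axis by blast
  next
    case False
    then obtain z where "exp (of_real t * z) = \<mu>" "z \<notin> resolvent_set D L"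
      using invertible_U[OF \<open>t \<noteq> 0\<close> \<open>\<mu> \<noteq> 0\<close>] ni by blast
    then show ?thesis unfolding spectrum_def by blast
  qed
next
  fix \<mu> assume "\<mu> \<in> (\<lambda>z. exp (of_real t * z)) ` spectrum D L"
  then obtain z where z: "\<mu> = exp (of_real t * z)" "z \<notin> resolvent_set D L"
    unfolding spectrum_def by blast
  then have "\<not> invertible_elem (scalar_op \<mu> - U t)"
    using spectral_inclusion[OF _ \<open>t \<noteq> 0\<close>] by blast
  then show "\<mu> \<in> spectrum UNIV (V t)"
    by (simp add: generates_unique[OF gen] spectrum_def resolvent_set_app)
qed

end

section \<open>The Euler operator\<close>

definition sqnorm :: "int \<times> int \<Rightarrow> int" where
  "sqnorm k = (fst k)\<^sup>2 + (snd k)\<^sup>2"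

definition cross :: "int \<times> int \<Rightarrow> int \<times> int \<Rightarrow> int" where
  "cross a b = fst a * snd b - snd a * fst b"

lemma enorm_sq: "(enorm a)\<^sup>2 = of_int (sqnorm a)"
  by (simp add: enorm_def norm_Pair sqnorm_def)

lemma sqnorm_pos: "a \<noteq> 0 \<Longrightarrow> 1 \<le> sqnorm a"
proof -
  assume "a \<noteq> 0"
  then have "0 < (fst a)\<^sup>2 + (snd a)\<^sup>2"
    by (simp add: sum_power2_gt_zero_iff prod_eq_iff)
  then show ?thesis by (simp add: sqnorm_def)
qed

lemma sqnorm_uminus [simp]: "sqnorm (- a) = sqnorm a"
  by (simp add: sqnorm_def)

lemma cross_shift [simp]: "cross p (k + p) = cross p k" "cross p (k - p) = cross p k"
  "cross (- p) k = - cross p k" "cross p p = 0" "cross p (- k) = - cross p k" "cross p 0 = 0"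
  by (simp_all add: cross_def algebra_simps)

text \<open>Cauchy-Schwarz, read off from Lagrange's identity.\<close>

lemma cross_sq_le: "(cross a b)\<^sup>2 \<le> sqnorm a * sqnorm b"
proof -
  have "sqnorm a * sqnorm b = (cross a b)\<^sup>2 + (fst a * fst b + snd a * snd b)\<^sup>2"
    by (simp add: sqnorm_def cross_def power2_eq_square algebra_simps)
  then show ?thesis by simp
qed

lemma euler_coeff_cross:
  assumes "cross a b \<noteq> 0"
  shows "euler_coeff a b = 1 / 2 * (1 / of_int (sqnorm a) - 1 / of_int (sqnorm b)) * of_int (cross a b)"
proof -
  have "a \<noteq> b" "a \<noteq> - b" "a \<noteq> 0" "b \<noteq> 0"
    using assms by (auto simp: cross_def)
  then show ?thesis by (simp add: euler_coeff_def enorm_sq cross_def)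
qed

lemma euler_coeff_zero: "cross a b = 0 \<Longrightarrow> euler_coeff a b = 0"
  by (simp add: euler_coeff_def cross_def)

text \<open>The cross product is bounded on each strip, so this crude estimate makes every
  truncation of \<open>L\<close> a bounded operator.\<close>

lemma abs_euler_coeff_le: "\<bar>euler_coeff a b\<bar> \<le> \<bar>of_int (cross a b)\<bar>"
proof (cases "cross a b = 0")
  case False
  then have "a \<noteq> 0" "b \<noteq> 0" by (auto simp: cross_def)
  then have n: "1 \<le> real_of_int (sqnorm a)" "1 \<le> real_of_int (sqnorm b)"
    using sqnorm_pos[of a] sqnorm_pos[of b] by simp_all
  have "\<bar>1 / real_of_int (sqnorm a) - 1 / real_of_int (sqnorm b)\<bar> \<le> 1"
  proof -
    have "0 \<le> 1 / real_of_int (sqnorm a)" "1 / real_of_int (sqnorm a) \<le> 1"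
      "0 \<le> 1 / real_of_int (sqnorm b)" "1 / real_of_int (sqnorm b) \<le> 1"
      using n by auto
    then show ?thesis by linarith
  qed
  then have "\<bar>1 / 2 * (1 / real_of_int (sqnorm a) - 1 / real_of_int (sqnorm b))\<bar> \<le> 1"
    unfolding abs_mult by simp
  then show ?thesis
    unfolding euler_coeff_cross[OF False] abs_mult[of _ "of_int (cross a b)"]
    by (intro mult_left_le_one_le) auto
qed (simp add: euler_coeff_zero)

section \<open>Invariant strips and the truncated operators\<close>

locale euler =
  fixes p :: "int \<times> int" and \<Gamma> :: complex
  assumes p: "p \<noteq> 0" and \<Gamma>: "\<Gamma> \<noteq> 0"
begin

definition strip :: "nat \<Rightarrow> (int \<times> int) set" where
  "strip n = {k. \<bar>cross p k\<bar> \<le> sqnorm p + int n}"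

lemma strip_shift [simp]: "k + p \<in> strip n \<longleftrightarrow> k \<in> strip n" "k - p \<in> strip n \<longleftrightarrow> k \<in> strip n"
  by (simp_all add: strip_def)

lemma strip_mono: "m \<le> n \<Longrightarrow> strip m \<subseteq> strip n"
  by (auto simp: strip_def)

definition trunc :: "nat \<Rightarrow> (int \<times> int) cop" where
  "trunc n = wshift (\<lambda>k. if k \<in> strip n then of_real (euler_coeff p (k - p)) * \<Gamma> else 0) (\<lambda>k. k - p)
     + wshift (\<lambda>k. if k \<in> strip n then of_real (euler_coeff (- p) (k + p)) * cnj \<Gamma> else 0) (\<lambda>k. k + p)"

lemma coord_trunc:
  "coord (app (trunc n) x) k = (if k \<in> strip n then euler_seq p \<Gamma> (coord x) k else 0)"
proof -
  define B where "B = of_int (sqnorm p + int n) * cmod \<Gamma>"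
  have B: "cmod (if k \<in> strip n then of_real c * g else 0) \<le> B"
    if "\<bar>c\<bar> \<le> \<bar>of_int (cross p k)\<bar>" "cmod g = cmod \<Gamma>" for c g k
  proof (cases "k \<in> strip n")
    case True
    then have "\<bar>real_of_int (cross p k)\<bar> \<le> of_int (sqnorm p + int n)"
      unfolding strip_def by (simp only: mem_Collect_eq of_int_le_iff of_int_abs[symmetric])
    then have "\<bar>c\<bar> \<le> of_int (sqnorm p + int n)" using that(1) by (rule order_trans[rotated])
    then show ?thesis using True by (simp add: norm_mult that(2) B_def mult_right_mono del: of_int_add)
  next
    case False
    have "0 \<le> sqnorm p" by (simp add: sqnorm_def)
    then show ?thesis using False by (simp add: B_def)
  qed
  have "cmod (if k \<in> strip n then of_real (euler_coeff p (k - p)) * \<Gamma> else 0) \<le> B" for k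
    using abs_euler_coeff_le[of p "k - p"] by (intro B) auto
  moreover have "cmod (if k \<in> strip n then of_real (euler_coeff (- p) (k + p)) * cnj \<Gamma> else 0) \<le> B" for k
    using abs_euler_coeff_le[of "- p" "k + p"] by (intro B) auto
  ultimately show ?thesis
    by (simp add: trunc_def plus_ell2.rep_eq coord_wshift[where B = B] inj_def euler_seq_def)
qed

lemma trunc_proj: "m \<le> n \<Longrightarrow> trunc n * proj (strip m) = trunc m"
  using strip_mono[of m n] by (intro cop_eqI ell2_eqI) (auto simp: coord_trunc euler_seq_def)

lemma proj_trunc: "m \<le> n \<Longrightarrow> proj (strip m) * trunc n = trunc m"
  using strip_mono[of m n] by (intro cop_eqI ell2_eqI) (auto simp: coord_trunc)

lemma strip_cover: "\<exists>n. k \<in> strip n"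
proof -
  have "0 \<le> sqnorm p" by (simp add: sqnorm_def)
  then have "k \<in> strip (nat \<bar>cross p k\<bar>)" by (simp add: strip_def)
  then show ?thesis ..
qed

text \<open>Every lattice point lies in some strip, so agreement on all strips says that the formal
  sequence \<open>L x\<close> is \<open>y\<close>. As \<open>y\<close> is square summable,
  \<open>x\<close> then belongs to the maximal domain.\<close>

lemma euler_graph:
  "x \<in> euler_dom p \<Gamma> \<and> euler_op p \<Gamma> x = y \<longleftrightarrow> (\<forall>n. app (trunc n) x = app (proj (strip n)) y)"
proof
  assume "x \<in> euler_dom p \<Gamma> \<and> euler_op p \<Gamma> x = y"
  then have "coord y = euler_seq p \<Gamma> (coord x)"
    by (auto simp: euler_dom_def euler_op_def Abs_ell2_inverse)
  then show "\<forall>n. app (trunc n) x = app (proj (strip n)) y"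
    by (auto intro!: ell2_eqI simp: coord_trunc)
next
  assume eq: "\<forall>n. app (trunc n) x = app (proj (strip n)) y"
  have "euler_seq p \<Gamma> (coord x) = coord y"
  proof
    fix k
    obtain n where "k \<in> strip n" using strip_cover by blast
    then show "euler_seq p \<Gamma> (coord x) k = coord y k"
      using arg_cong[OF spec[OF eq, of n], of "\<lambda>w. coord w k"] by (simp add: coord_trunc)
  qed
  then show "x \<in> euler_dom p \<Gamma> \<and> euler_op p \<Gamma> x = y"
    by (simp add: euler_dom_def euler_op_def square_summable_coord coord_inverse)
qed

section \<open>The conserved weighted energy\<close>

definition weight :: "int \<times> int \<Rightarrow> real" where
  "weight k = (if k \<in> strip 0 then 0 else 1 / of_int (sqnorm p) - 1 / of_int (sqnorm k))"

text \<open>The value of the weight formula at |k|^2 = |p|^2 + 1. By Cauchy-Schwarz every point off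
  \<open>strip 0\<close> has at least this squared length, so \<open>gap\<close> is a positive lower
  bound for the weight there.\<close>

definition gap :: real where
  "gap = 1 / of_int (sqnorm p) - 1 / of_int (sqnorm p + 1)"

lemma gap_pos: "0 < gap"
  unfolding gap_def diff_gt_0_iff_gt
  using sqnorm_pos[OF p] by (intro divide_strict_left_mono) auto

lemma weight_bounds: "0 \<le> weight k" "weight k \<le> 1" "k \<notin> strip 0 \<Longrightarrow> gap \<le> weight k"
proof -
  have n: "1 \<le> sqnorm p" by (rule sqnorm_pos[OF p])
  have lower: "gap \<le> weight k" if "k \<notin> strip 0"
  proof -
    have "sqnorm p + 1 \<le> \<bar>cross p k\<bar>" using that by (simp add: strip_def)
    then have "(sqnorm p + 1)\<^sup>2 \<le> \<bar>cross p k\<bar>\<^sup>2" using n by (intro power_mono) auto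
    then have "(sqnorm p + 1)\<^sup>2 \<le> sqnorm p * sqnorm k" using cross_sq_le[of p k] by simp
    moreover have "sqnorm p * (sqnorm p + 1) \<le> (sqnorm p + 1)\<^sup>2"
      using n by (simp add: power2_eq_square algebra_simps)
    ultimately have "sqnorm p * (sqnorm p + 1) \<le> sqnorm p * sqnorm k" by linarith
    then have "sqnorm p + 1 \<le> sqnorm k" using n by simp
    then have "1 / real_of_int (sqnorm k) \<le> 1 / of_int (sqnorm p + 1)"
      using n by (intro divide_left_mono) auto
    then show ?thesis using that by (simp add: weight_def gap_def)
  qed
  then show "k \<notin> strip 0 \<Longrightarrow> gap \<le> weight k" .
  show "0 \<le> weight k"
    using lower gap_pos by (cases "k \<in> strip 0") (auto simp: weight_def)
  have "0 \<le> sqnorm k" by (simp add: sqnorm_def)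
  moreover have "1 / real_of_int (sqnorm p) \<le> 1" using n by simp
  ultimately show "weight k \<le> 1"
    by (auto simp: weight_def intro: order_trans[of _ "1 / real_of_int (sqnorm p)"])
qed

text \<open>The energy of \<open>x\<close> is the squared norm of \<open>sqrt_weight\<close> applied
  to \<open>x\<close>. The square root makes sense because the weight is set to 0 on
  \<open>strip 0\<close>, where its formula may be negative.\<close>

definition sqrt_weight :: "(int \<times> int) cop" where
  "sqrt_weight = wshift (\<lambda>k. of_real (sqrt (weight k))) id"

lemma coord_sqrt_weight: "coord (app sqrt_weight x) k = of_real (sqrt (weight k)) * coord x k"
  unfolding sqrt_weight_def by (subst coord_wshift[where B = 1]) (simp_all add: weight_bounds)

lemma norm_sqrt_weight: "norm (app sqrt_weight x) \<le> norm x"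
  unfolding sqrt_weight_def
  by (rule order_trans[OF norm_wshift[where B = 1]]) (simp_all add: weight_bounds)

definition unweight :: "(int \<times> int) cop" where
  "unweight = wshift (\<lambda>k. if k \<in> strip 0 then 0 else of_real (1 / sqrt (weight k))) id"

lemma unweight_bound: "cmod (if k \<in> strip 0 then 0 else of_real (1 / sqrt (weight k))) \<le> 1 / sqrt gap"
proof (cases "k \<in> strip 0")
  case False
  then have "cmod (of_real (1 / sqrt (weight k))) = 1 / sqrt (weight k)"
    unfolding norm_of_real using weight_bounds(1) by simp
  also have "\<dots> \<le> 1 / sqrt gap"
    using weight_bounds(3)[OF False] gap_pos by (intro divide_left_mono) auto
  finally show ?thesis using False by simp
qed (use gap_pos in simp)

lemma norm_unweight: "norm (app unweight x) \<le> 1 / sqrt gap * norm x"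
  unfolding unweight_def by (rule norm_wshift) (use unweight_bound in auto)

lemma unweight_sqrt_weight: "unweight * sqrt_weight = 1 - proj (strip 0)"
proof (intro cop_eqI ell2_eqI)
  fix x k
  have "coord (app unweight (app sqrt_weight x)) k
      = (if k \<in> strip 0 then 0 else of_real (1 / sqrt (weight k))) * coord (app sqrt_weight x) (id k)"
    unfolding unweight_def by (rule coord_wshift[OF _ unweight_bound]) simp
  moreover have "weight k > 0" if "k \<notin> strip 0" using weight_bounds(3)[OF that] gap_pos by linarith
  ultimately show "coord (app (unweight * sqrt_weight) x) k = coord (app (1 - proj (strip 0)) x) k"
    by (auto simp: coord_sqrt_weight minus_ell2.rep_eq)
qed

text \<open>
  Off \<open>strip 0\<close> the operator is \<open>\<alpha> (S - S\<^sup>*) weight\<close> with a shift-invariant factor \<open>\<alpha>\<close> and a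
  weighted shift \<open>S\<close>, so it is skew for the weighted inner product: the sum telescopes as
  \<open>g k - g (k + p)\<close>.
\<close>

lemma inner_trunc: "inner (app sqrt_weight x) (app sqrt_weight (app (trunc n) x)) = 0"
proof -
  define y where "y = app sqrt_weight (app sqrt_weight x)"
  \<comment> \<open>Cutting \<alpha> off outside \<open>strip n\<close> keeps \<open>W\<close>
    bounded. Nothing is lost on \<open>strip 0\<close>, where the weight and hence \<open>y\<close>
    vanish. Both strips are invariant under the shift by \<open>p\<close>, so \<alpha> is
    too.\<close>
  define \<alpha> where "\<alpha> k = (if k \<in> strip n - strip 0 then real_of_int (cross p k) / 2 else 0)" for k
  define W where "W = wshift (\<lambda>k. of_real (\<alpha> k) * \<Gamma>) (\<lambda>k. k - p)"
  define g where "g k = \<alpha> k * Re (coord y k * cnj (\<Gamma> * coord y (k - p)))" for k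
  have y: "coord y k = of_real (weight k) * coord x k" for k
    using weight_bounds(1)[of k]
    by (simp add: y_def coord_sqrt_weight mult.assoc[symmetric] flip: of_real_mult)
  have \<alpha>: "\<alpha> (k + p) = \<alpha> k" for k by (simp add: \<alpha>_def)
  have "cmod (of_real (\<alpha> k) * \<Gamma>) \<le> of_int (sqnorm p + int n) * cmod \<Gamma>" for k
  proof -
    have "\<bar>\<alpha> k\<bar> \<le> of_int (sqnorm p + int n)"
    proof (cases "k \<in> strip n - strip 0")
      case True
      then have "\<bar>real_of_int (cross p k)\<bar> \<le> of_int (sqnorm p + int n)"
        unfolding strip_def by (simp only: mem_Collect_eq of_int_le_iff of_int_abs[symmetric] Diff_iff)
      then show ?thesis using True by (simp add: \<alpha>_def)
    next
      case False
      have "0 \<le> sqnorm p" by (simp add: sqnorm_def)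
      then show ?thesis using False by (auto simp: \<alpha>_def)
    qed
    then show ?thesis by (simp add: norm_mult mult_right_mono del: of_int_add)
  qed
  then have W: "coord (app W y) k = of_real (\<alpha> k) * \<Gamma> * coord y (k - p)" for k
    unfolding W_def by (intro coord_wshift) (auto simp: inj_def)
  \<comment> \<open>Needed to split the telescoping sum into two; \<open>g\<close> is the summand of
    the inner product of \<open>y\<close> with \<open>W y\<close>.\<close>
  have g_sum: "g summable_on UNIV"
    using inner_summable[of y "app W y"]
    by (simp add: W g_def[abs_def] algebra_simps)
  have bij: "bij_betw (\<lambda>k. k + p) UNIV UNIV"
    by (rule bij_betwI[where g = "\<lambda>k. k - p"]) auto
  have g_sum': "(\<lambda>k. g (k + p)) summable_on UNIV"
    using g_sum summable_on_reindex_bij_betw[OF bij, of g] by simp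
  have summand: "Re (coord (app sqrt_weight x) k * cnj (coord (app sqrt_weight (app (trunc n) x)) k))
      = g k - g (k + p)" for k
  proof -
    have "coord (app sqrt_weight x) k * cnj (coord (app sqrt_weight (app (trunc n) x)) k)
        = coord y k * cnj (coord (app (trunc n) x) k)"
      using weight_bounds(1)[of k]
      by (simp add: coord_sqrt_weight y mult.assoc mult.left_commute flip: of_real_mult)
    also have "Re \<dots> = g k - g (k + p)"
    proof (cases "k \<in> strip n - strip 0")
      case False
      then show ?thesis by (auto simp: \<alpha> g_def) (auto simp: \<alpha>_def coord_trunc y weight_def)
    next
      case True
      then have k: "k \<in> strip n" "k \<notin> strip 0" by auto
      have "0 \<le> sqnorm p" by (simp add: sqnorm_def)
      then have c: "cross p k \<noteq> 0" using k(2) by (auto simp: strip_def)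
      have "euler_coeff p (k - p) = \<alpha> k * weight (k - p)"
        using True c by (subst euler_coeff_cross) (auto simp: \<alpha>_def weight_def)
      \<comment> \<open>The sign comes from the antisymmetry of the cross product and is the source
        of skewness.\<close>
      moreover have "euler_coeff (- p) (k + p) = - \<alpha> k * weight (k + p)"
        using True c by (subst euler_coeff_cross) (auto simp: \<alpha>_def weight_def)
      ultimately have "coord (app (trunc n) x) k
          = of_real (\<alpha> k) * (\<Gamma> * coord y (k - p) - cnj \<Gamma> * coord y (k + p))"
        using k(1) by (simp add: coord_trunc euler_seq_def y algebra_simps)
      then show ?thesis
        by (simp only: g_def \<alpha>) (simp add: algebra_simps)
    qed
    finally show ?thesis .
  qed
  have "inner (app sqrt_weight x) (app sqrt_weight (app (trunc n) x)) = (\<Sum>\<^sub>\<infinity>k. g k - g (k + p))"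
    unfolding inner_ell2_def by (simp only: summand)
  also have "\<dots> = (\<Sum>\<^sub>\<infinity>k. g k) - (\<Sum>\<^sub>\<infinity>k. g (k + p))"
    using infsum_add[OF g_sum summable_on_uminus[THEN iffD2, OF g_sum']]
    by (simp add: infsum_uminus)
  also have "\<dots> = 0" using infsum_reindex_bij_betw[OF bij, of g] by simp
  finally show ?thesis .
qed

text \<open>In the constant, 2 bounds the norm of \<open>1 - proj (strip 0)\<close>, and
  \<open>1 / sqrt gap\<close> is the price of returning from the conserved energy to the
  norm.\<close>

lemma norm_exp_trunc_off: "norm (exp (t *\<^sub>R trunc n) * (1 - proj (strip 0))) \<le> 2 / sqrt gap"
proof (rule norm_cop_bound)
  show "0 \<le> 2 / sqrt gap" using gap_pos by simp
  fix x
  define q where "q = 1 - proj (strip 0)"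
  define u where "u t = app (exp (t *\<^sub>R trunc n)) (app q x)" for t
  define f where "f t = inner (app sqrt_weight (u t)) (app sqrt_weight (u t))" for t
  have "(f has_vector_derivative 0) (at s)" for s
  proof -
    have "((\<lambda>t. app (exp (t *\<^sub>R trunc n)) (app q x)) has_vector_derivative
        app (trunc n * exp (s *\<^sub>R trunc n)) (app q x)) (at s)"
      by (rule app_exp_derivative)
    then have "(u has_vector_derivative app (trunc n) (u s)) (at s)" by (simp add: u_def[abs_def])
    then have "((\<lambda>t. app sqrt_weight (u t)) has_vector_derivative app sqrt_weight (app (trunc n) (u s))) (at s)"
      by (rule bounded_linear.has_vector_derivative[OF bounded_linear_app])
    then have "(f has_vector_derivative
        inner (app sqrt_weight (u s)) (app sqrt_weight (app (trunc n) (u s)))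
        + inner (app sqrt_weight (app (trunc n) (u s))) (app sqrt_weight (u s))) (at s)"
      unfolding f_def by (intro bounded_bilinear.has_vector_derivative[OF bounded_bilinear_inner])
    then show ?thesis by (simp add: inner_trunc inner_commute[of "app sqrt_weight (app (trunc n) _)"])
  qed
  then have "f t = f 0"
    using has_vector_derivative_zero_constant[of UNIV f] by (metis UNIV_I convex_UNIV)
  then have "norm (app sqrt_weight (u t)) = norm (app sqrt_weight (u 0))"
    by (simp add: f_def norm_eq_sqrt_inner)
  also have "\<dots> \<le> norm (app q x)" by (simp add: u_def norm_sqrt_weight)
  also have "\<dots> \<le> 2 * norm x"
    using norm_triangle_ineq4[of x "app (proj (strip 0)) x"] norm_proj[of "strip 0" x]
    by (simp add: q_def)
  finally have bound: "norm (app sqrt_weight (u t)) \<le> 2 * norm x" .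
  \<comment> \<open>The orbit never enters \<open>strip 0\<close>, so \<open>unweight\<close>
    recovers it from its weighted version.\<close>
  have "q * (t *\<^sub>R trunc n) = (t *\<^sub>R trunc n) * q"
    by (simp add: q_def left_diff_distrib right_diff_distrib scaleR_diff_right trunc_proj proj_trunc)
  then have "q * exp (t *\<^sub>R trunc n) = exp (t *\<^sub>R trunc n) * q" by (rule exp_intertwine)
  moreover have "q * q = q"
    by (simp add: q_def left_diff_distrib right_diff_distrib proj_mult)
  ultimately have "exp (t *\<^sub>R trunc n) * q = q * (exp (t *\<^sub>R trunc n) * q)"
    by (metis mult.assoc)
  then have "app (exp (t *\<^sub>R trunc n) * q) x = app q (u t)"
    by (metis app_simps(6) u_def)
  also have "\<dots> = app unweight (app sqrt_weight (u t))"
    by (simp add: q_def unweight_sqrt_weight[symmetric])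
  finally have "norm (app (exp (t *\<^sub>R trunc n) * q) x) \<le> 1 / sqrt gap * norm (app sqrt_weight (u t))"
    using norm_unweight by simp
  also have "\<dots> \<le> 1 / sqrt gap * (2 * norm x)"
    using gap_pos by (intro mult_left_mono bound) auto
  finally show "norm (app (exp (t *\<^sub>R trunc n) * (1 - proj (strip 0))) x) \<le> 2 / sqrt gap * norm x"
    by (simp add: q_def)
qed

sublocale exhausted_operator strip trunc "euler_dom p \<Gamma>" "euler_op p \<Gamma>" "2 / sqrt gap"
  by standard (rule strip_mono strip_cover trunc_proj proj_trunc euler_graph norm_exp_trunc_off | assumption)+

section \<open>The imaginary axis lies in the spectrum\<close>

lemma trunc_basis_vec:
  assumes "k \<in> strip n"
  shows "app (trunc n) (basis_vec k)
    = (of_real (euler_coeff p k) * \<Gamma>) *\<^sub>C basis_vec (k + p)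
      + (of_real (euler_coeff (- p) k) * cnj \<Gamma>) *\<^sub>C basis_vec (k - p)"
proof (rule ell2_eqI)
  fix l
  have "l - p = k \<longleftrightarrow> l = k + p" "l + p = k \<longleftrightarrow> l = k - p" "- p \<noteq> p"
    using p by (auto simp: prod_eq_iff)
  then show "coord (app (trunc n) (basis_vec k)) l
    = coord ((of_real (euler_coeff p k) * \<Gamma>) *\<^sub>C basis_vec (k + p)
      + (of_real (euler_coeff (- p) k) * cnj \<Gamma>) *\<^sub>C basis_vec (k - p)) l"
    using assms by (auto simp: coord_trunc euler_seq_def plus_ell2.rep_eq scaleC.rep_eq basis_vec.rep_eq)
qed

lemma coord_sum: "coord (sum f I) k = (\<Sum>i\<in>I. coord (f i) k)"
  by (induction I rule: infinite_finite_induct) (simp_all add: zero_ell2.rep_eq plus_ell2.rep_eq)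

text \<open>The bracket is 2i times the imaginary part of \<open>\<Gamma> * cnj u\<close>, and this
  part takes every value between \<open>- cmod \<Gamma>\<close> and \<open>cmod \<Gamma>\<close> as
  \<open>u\<close> runs over the unit circle. The left side of the equation is the symbol of the
  limiting constant coefficient operator on the line at height \<open>m\<close>.\<close>

lemma unit_symbol:
  assumes "0 < m" "\<bar>\<tau>\<bar> \<le> m * cmod \<Gamma>"
  obtains u where "cmod u = 1" "of_real (m / 2) * (\<Gamma> * cnj u - cnj \<Gamma> * u) = \<i> * of_real \<tau>"
proof -
  define s where "s = \<tau> / (m * cmod \<Gamma>)"
  have mG: "0 < m * cmod \<Gamma>" using assms(1) \<Gamma> by simp
  have "\<bar>s\<bar> \<le> 1" using assms(2) mG by (simp add: s_def abs_divide)
  then have s: "s\<^sup>2 \<le> 1" by (simp add: abs_square_le_1)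
  define w where "w = Complex (sqrt (1 - s\<^sup>2)) s"
  have w: "cmod w = 1" using s by (simp add: w_def cmod_def)
  have G: "\<Gamma> * cnj \<Gamma> = of_real ((cmod \<Gamma>)\<^sup>2)" by (simp only: complex_norm_square)
  define u where "u = \<Gamma> / of_real (cmod \<Gamma>) * cnj w"
  have "cmod u = 1" using w \<Gamma> by (simp add: u_def norm_mult norm_divide)
  moreover have "\<Gamma> * cnj u = of_real (cmod \<Gamma>) * w"
    using G \<Gamma> by (simp add: u_def field_simps power2_eq_square)
  moreover have "cnj \<Gamma> * u = of_real (cmod \<Gamma>) * cnj w"
    using G \<Gamma> by (simp add: u_def field_simps power2_eq_square)
  moreover have "w - cnj w = \<i> * of_real (2 * s)"
    by (simp add: w_def complex_eq_iff)
  ultimately have "of_real (m / 2) * (\<Gamma> * cnj u - cnj \<Gamma> * u)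
      = of_real (m / 2) * (of_real (cmod \<Gamma>) * (\<i> * of_real (2 * s)))"
    by (simp only: right_diff_distrib[symmetric])
  also have "\<dots> = \<i> * of_real (m * cmod \<Gamma> * s)" by simp
  also have "m * cmod \<Gamma> * s = \<tau>" using assms(1) \<Gamma> by (simp add: s_def)
  finally show thesis using that \<open>cmod u = 1\<close> by blast
qed

text \<open>The point j p + m p', where p' is \<open>p\<close> rotated by a right angle.
  Orthogonality of the two summands keeps the squared length explicit, and a shift by
  \<open>p\<close> moves \<open>j\<close> by one.\<close>

definition site :: "int \<Rightarrow> int \<Rightarrow> int \<times> int" where
  "site m j = (j * fst p - m * snd p, j * snd p + m * fst p)"

lemma site: "cross p (site m j) = m * sqnorm p" "sqnorm (site m j) = (m\<^sup>2 + j\<^sup>2) * sqnorm p"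
  "site m j + p = site m (j + 1)" "site m j - p = site m (j - 1)"
  by (simp_all add: site_def cross_def sqnorm_def power2_eq_square algebra_simps prod_eq_iff)

lemma site_inj: "site m i = site m j \<longleftrightarrow> i = j"
proof
  assume "site m i = site m j"
  then have "i * fst p = j * fst p" "i * snd p = j * snd p" by (simp_all add: site_def)
  then show "i = j" using p by (auto simp: prod_eq_iff)
qed simp

lemma trunc_site:
  assumes "0 < m"
  defines "r \<equiv> \<lambda>j. of_int m / 2 * (1 - 1 / of_int (m\<^sup>2 + j\<^sup>2))"
  shows "app (trunc (nat (m * sqnorm p))) (basis_vec (site m j))
    = (of_real (r j) * \<Gamma>) *\<^sub>C basis_vec (site m (j + 1)) - (of_real (r j) * cnj \<Gamma>) *\<^sub>C basis_vec (site m (j - 1))"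
    and "site m j \<in> strip (nat (m * sqnorm p))"
proof -
  have N: "1 \<le> sqnorm p" by (rule sqnorm_pos[OF p])
  then have mN: "0 < m * sqnorm p" using assms(1) by simp
  show s: "site m j \<in> strip (nat (m * sqnorm p))"
    using N mN by (simp add: strip_def site)
  have "0 < m\<^sup>2 + j\<^sup>2" using assms(1) by (simp add: add_pos_nonneg)
  then have q: "real_of_int (m\<^sup>2 + j\<^sup>2) \<noteq> 0" by linarith
  have N': "real_of_int (sqnorm p) \<noteq> 0" using N by simp
  have r: "1 / 2 * (1 / real_of_int (sqnorm p) - 1 / of_int ((m\<^sup>2 + j\<^sup>2) * sqnorm p)) * of_int (m * sqnorm p) = r j"
  proof -
    have "1 / 2 * (1 / a - 1 / (b * a)) * (c * a) = c / 2 * (1 - 1 / b)" if "a \<noteq> 0" "b \<noteq> 0" for a b c :: real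
      using that by (simp add: field_simps)
    then show ?thesis unfolding r_def of_int_mult using q N' by blast
  qed
  have "euler_coeff p (site m j) = r j"
    by (subst euler_coeff_cross) (use N assms(1) r in \<open>simp_all add: site\<close>)
  moreover have "euler_coeff (- p) (site m j) = - r j"
    by (subst euler_coeff_cross) (use N assms(1) r in \<open>simp_all add: site\<close>)
  ultimately show "app (trunc (nat (m * sqnorm p))) (basis_vec (site m j))
    = (of_real (r j) * \<Gamma>) *\<^sub>C basis_vec (site m (j + 1)) - (of_real (r j) * cnj \<Gamma>) *\<^sub>C basis_vec (site m (j - 1))"
    by (simp add: trunc_basis_vec[OF s] site)
qed

lemma summable_inverse_one_plus_square: "summable (\<lambda>j::nat. 1 / (1 + (real j)\<^sup>2))"
proof (rule summable_comparison_test)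
  show "\<exists>N. \<forall>n\<ge>N. norm (1 / (1 + (real n)\<^sup>2)) \<le> inverse (real n ^ 2)"
    by (intro exI[of _ 1]) (auto simp: inverse_eq_divide intro!: frac_le)
  show "summable (\<lambda>n. inverse (real n ^ 2))"
    by (rule inverse_power_summable) simp
qed

text \<open>
  On the lattice line \<open>site m\<close> the coefficients are \<open>r - s j\<close> with \<open>s\<close> summable. A truncated plane wave
  \<open>u ^ j\<close> of the constant coefficient operator leaves two telescoping boundary terms and a summable
  error, both bounded independently of the length \<open>M\<close>.
\<close>

lemma approximate_eigenvectors:
  obtains n x B where "\<And>M. app (proj (strip n)) (x M) = x M" "\<And>M. sqrt (real M) \<le> norm (x M)"
    "\<And>M. norm ((\<i> * of_real \<tau>) *\<^sub>C x M - app (trunc n) (x M)) \<le> B"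
proof -
  \<comment> \<open>The symbol at height \<open>m\<close> only covers imaginary numbers of modulus
    at most \<open>m * cmod \<Gamma>\<close>, so the line is chosen according to \<tau>.\<close>
  obtain k :: nat where k: "\<bar>\<tau>\<bar> / cmod \<Gamma> \<le> real k" using real_arch_simple by blast
  define m where "m = int k + 1"
  have m: "1 \<le> m" by (simp add: m_def)
  have "\<bar>\<tau>\<bar> \<le> real k * cmod \<Gamma>" using k \<Gamma> by (simp add: divide_le_eq)
  also have "\<dots> \<le> of_int m * cmod \<Gamma>" by (simp add: m_def mult_right_mono)
  finally have tau_le: "\<bar>\<tau>\<bar> \<le> of_int m * cmod \<Gamma>" .
  have "0 < real_of_int m" using m by simp
  from unit_symbol[OF this tau_le] obtain u where u: "cmod u = 1" and
    symb: "of_real (of_int m / 2) * (\<Gamma> * cnj u - cnj \<Gamma> * u) = \<i> * of_real \<tau>"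
    by blast
  have uu: "u * cnj u = 1" by (simp only: complex_norm_square[symmetric] u) simp
  define n where "n = nat (m * sqnorm p)"
  define e where "e j = basis_vec (site m j)" for j
  define r where "r = of_int m / (2 :: real)"
  define s where "s j = r / of_int (m\<^sup>2 + j\<^sup>2)" for j :: int
  define x where "x M = (\<Sum>j<M. (u ^ j) *\<^sub>C e (int j))" for M :: nat
  \<comment> \<open>The coefficient is the power of \<open>u\<close> with exponent j - 1, written
    with \<open>cnj u\<close> so that it makes sense at j = 0.\<close>
  define f where "f j = (u ^ j * cnj u) *\<^sub>C e (int j)" for j :: nat
  define g where "g j = (u ^ j) *\<^sub>C e (int j - 1)" for j :: nat
  define err where "err j = (of_real (s (int j)) * \<Gamma> * u ^ j) *\<^sub>C e (int j + 1)
      - (of_real (s (int j)) * cnj \<Gamma> * u ^ j) *\<^sub>C e (int j - 1)" for j :: nat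
  have Te: "app (trunc n) (e j) = (of_real (r - s j) * \<Gamma>) *\<^sub>C e (j + 1) - (of_real (r - s j) * cnj \<Gamma>) *\<^sub>C e (j - 1)" for j
  proof -
    have "of_int m / 2 * (1 - 1 / of_int (m\<^sup>2 + j\<^sup>2)) = r - s j"
      by (simp add: r_def s_def right_diff_distrib)
    moreover have "0 < m" using m by simp
    ultimately show ?thesis using trunc_site(1)[of m j] unfolding n_def e_def by metis
  qed
  have resid: "(\<i> * of_real \<tau>) *\<^sub>C (u ^ j) *\<^sub>C e (int j) - app (trunc n) ((u ^ j) *\<^sub>C e (int j))
      = (of_real r * \<Gamma>) *\<^sub>C (f j - f (Suc j)) - (of_real r * cnj \<Gamma>) *\<^sub>C (g (Suc j) - g j) + err j" for j
  proof (rule ell2_eqI)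
    fix l
    have tau: "\<i> * of_real \<tau> = of_real r * (\<Gamma> * cnj u - cnj \<Gamma> * u)" using symb by (simp add: r_def)
    have fS: "f (Suc j) = (u ^ j) *\<^sub>C e (int j + 1)"
      using uu by (simp add: f_def mult.assoc mult.left_commute[of u] add.commute)
    have gS: "g (Suc j) = (u ^ j * u) *\<^sub>C e (int j)" by (simp add: g_def mult.commute)
    show "coord ((\<i> * of_real \<tau>) *\<^sub>C (u ^ j) *\<^sub>C e (int j) - app (trunc n) ((u ^ j) *\<^sub>C e (int j))) l
      = coord ((of_real r * \<Gamma>) *\<^sub>C (f j - f (Suc j)) - (of_real r * cnj \<Gamma>) *\<^sub>C (g (Suc j) - g j) + err j) l"
      unfolding tau fS gS app_simps Te
      by (simp add: f_def g_def err_def plus_ell2.rep_eq minus_ell2.rep_eq scaleC.rep_eq algebra_simps)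
  qed
  have scaleC_sum: "c *\<^sub>C sum h I = (\<Sum>i\<in>I. c *\<^sub>C h i)" for c and h :: "nat \<Rightarrow> (int \<times> int) ell2" and I
    by (rule linear_sum[OF bounded_linear.linear[OF bounded_linear_scaleC]])
  \<comment> \<open>The term \<open>4 * r * cmod \<Gamma>\<close> accounts for the four boundary
    vectors \<open>f 0\<close>, \<open>f M\<close>, \<open>g 0\<close>, \<open>g M\<close> of norm
    1; the series dominates the errors from the variable part of the coefficients.\<close>
  define B where "B = 4 * r * cmod \<Gamma> + 2 * r * cmod \<Gamma> * (\<Sum>j. 1 / (1 + (real j)\<^sup>2))"
  have r0: "0 \<le> r" using m by (simp add: r_def)
  have err: "norm (err j) \<le> 2 * r * cmod \<Gamma> * (1 / (1 + (real j)\<^sup>2))" for j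
  proof -
    have "1 \<le> m\<^sup>2" using m by (simp add: one_le_power)
    then have "1 + (real j)\<^sup>2 \<le> of_int (m\<^sup>2 + (int j)\<^sup>2)"
      by (metis add_right_mono of_int_1_le_iff of_int_add of_int_of_nat_eq of_int_power)
    then have s_le: "s (int j) \<le> r * (1 / (1 + (real j)\<^sup>2))"
      unfolding s_def using r0 by (simp add: frac_le add_pos_nonneg)
    have s0: "0 \<le> s (int j)" using r0 by (simp add: s_def)
    have "norm (err j) \<le> norm ((of_real (s (int j)) * \<Gamma> * u ^ j) *\<^sub>C e (int j + 1))
        + norm ((of_real (s (int j)) * cnj \<Gamma> * u ^ j) *\<^sub>C e (int j - 1))"
      unfolding err_def by (rule norm_triangle_ineq4)
    also have "\<dots> = 2 * cmod \<Gamma> * s (int j)"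
      using s0 by (simp add: e_def norm_mult norm_power u)
    also have "\<dots> \<le> 2 * cmod \<Gamma> * (r * (1 / (1 + (real j)\<^sup>2)))"
      by (rule mult_left_mono[OF s_le]) simp
    finally show ?thesis by (simp add: mult_ac)
  qed
  have "norm ((\<i> * of_real \<tau>) *\<^sub>C x M - app (trunc n) (x M)) \<le> B" for M
  proof -
    have tele: "(\<Sum>j<M. f j - f (Suc j)) = f 0 - f M" "(\<Sum>j<M. g (Suc j) - g j) = g M - g 0"
      by (rule sum_lessThan_telescope' sum_lessThan_telescope)+
    have "(\<i> * of_real \<tau>) *\<^sub>C x M - app (trunc n) (x M)
        = (\<Sum>j<M. (\<i> * of_real \<tau>) *\<^sub>C (u ^ j) *\<^sub>C e (int j) - app (trunc n) ((u ^ j) *\<^sub>C e (int j)))"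
      by (simp only: x_def scaleC_sum app_right_simps sum_subtractf)
    also have "\<dots> = (of_real r * \<Gamma>) *\<^sub>C (f 0 - f M) - (of_real r * cnj \<Gamma>) *\<^sub>C (g M - g 0) + sum err {..<M}"
      by (simp only: resid sum.distrib sum_subtractf scaleC_sum[symmetric] tele[unfolded sum_subtractf])
    also have "norm \<dots> \<le> r * cmod \<Gamma> * norm (f 0 - f M) + r * cmod \<Gamma> * norm (g M - g 0) + norm (sum err {..<M})"
      by (rule order_trans[OF norm_triangle_ineq add_right_mono[OF order_trans[OF norm_triangle_ineq4]]])
        (use r0 in \<open>simp add: norm_mult\<close>)
    also have "\<dots> \<le> r * cmod \<Gamma> * 2 + r * cmod \<Gamma> * 2 + 2 * r * cmod \<Gamma> * (\<Sum>j. 1 / (1 + (real j)\<^sup>2))"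
    proof (intro add_mono mult_left_mono)
      have nf: "norm (f j) = 1" "norm (g j) = 1" for j
        by (simp_all add: f_def g_def e_def norm_mult norm_power u)
      show "norm (f 0 - f M) \<le> 2" "norm (g M - g 0) \<le> 2"
        using norm_triangle_ineq4[of "f 0" "f M"] norm_triangle_ineq4[of "g M" "g 0"] by (simp_all add: nf)
      have "norm (sum err {..<M}) \<le> (\<Sum>j<M. 2 * r * cmod \<Gamma> * (1 / (1 + (real j)\<^sup>2)))"
        by (rule sum_norm_le) (rule err)
      also have "\<dots> = 2 * r * cmod \<Gamma> * (\<Sum>j<M. 1 / (1 + (real j)\<^sup>2))"
        by (rule sum_distrib_left[symmetric])
      also have "\<dots> \<le> 2 * r * cmod \<Gamma> * (\<Sum>j. 1 / (1 + (real j)\<^sup>2))"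
        by (intro mult_left_mono sum_le_suminf summable_inverse_one_plus_square) (use r0 in auto)
      finally show "norm (sum err {..<M}) \<le> 2 * r * cmod \<Gamma> * (\<Sum>j. 1 / (1 + (real j)\<^sup>2))" .
    qed (use r0 in auto)
    finally show ?thesis by (simp add: B_def)
  qed
  moreover have "app (proj (strip n)) (x M) = x M" for M
  proof -
    have "app (proj (strip n)) (e j) = e j" for j
      using trunc_site(2)[of m j] m by (intro ell2_eqI) (auto simp: e_def n_def basis_vec.rep_eq)
    then show ?thesis by (simp add: x_def)
  qed
  moreover have "sqrt (real M) \<le> norm (x M)" for M
  proof -
    define S where "S = (\<lambda>j. site m (int j)) ` {..<M}"
    have inj: "inj_on (\<lambda>j. site m (int j)) {..<M}" by (simp add: inj_on_def site_inj)
    have "coord (x M) (site m (int i)) = u ^ i" if "i < M" for i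
    proof -
      have "coord (x M) (site m (int i)) = (\<Sum>j<M. if j = i then u ^ i else 0)"
        unfolding x_def coord_sum
        by (rule sum.cong) (auto simp: scaleC.rep_eq e_def basis_vec.rep_eq site_inj)
      then show ?thesis using that by simp
    qed
    then have "L2_set (\<lambda>k. cmod (coord (x M) k)) S = sqrt (real M)"
      unfolding L2_set_def S_def by (subst sum.reindex[OF inj]) (simp add: norm_power u)
    then show ?thesis using L2_set_le_norm[of S "x M"] by (simp add: S_def)
  qed
  ultimately show thesis using that by blast
qed

text \<open>The approximate eigenvectors are left unnormalised: a bounded resolvent \<open>R\<close>
  would force \<open>norm (x M)\<close> below \<open>norm R * B\<close>, whereas it grows at least
  like \<open>sqrt M\<close>.\<close>

lemma imaginary_axis: "\<i> * of_real \<tau> \<in> spectrum (euler_dom p \<Gamma>) (euler_op p \<Gamma>)"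
proof (rule ccontr)
  let ?z = "\<i> * complex_of_real \<tau>"
  assume "\<i> * of_real \<tau> \<notin> spectrum (euler_dom p \<Gamma>) (euler_op p \<Gamma>)"
  then obtain F where F: "bounded_clinear F"
    "\<And>x. x \<in> euler_dom p \<Gamma> \<Longrightarrow> F (?z *\<^sub>C x - euler_op p \<Gamma> x) = x"
    unfolding spectrum_def resolvent_set_def by blast
  obtain R where R: "app R = F" by (rule bounded_clinear_appE[OF F(1)])
  obtain n x B where x: "\<And>M. app (proj (strip n)) (x M) = x M" "\<And>M. sqrt (real M) \<le> norm (x M)"
    "\<And>M. norm (?z *\<^sub>C x M - app (trunc n) (x M)) \<le> B"
    by (rule approximate_eigenvectors[of \<tau>]) (rule that)
  have le: "sqrt (real M) \<le> norm R * B" for M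
  proof -
    have "x M \<in> euler_dom p \<Gamma>" "euler_op p \<Gamma> (x M) = app (trunc n) (x M)"
      using graph_proj[of n "x M"] by (simp_all add: x(1))
    then have "x M = app R (?z *\<^sub>C x M - app (trunc n) (x M))" using F(2)[of "x M"] by (simp only: R)
    then have "norm (x M) \<le> norm R * norm (?z *\<^sub>C x M - app (trunc n) (x M))"
      using norm_app by metis
    also have "\<dots> \<le> norm R * B" by (rule mult_left_mono[OF x(3)]) simp
    finally show ?thesis using x(2)[of M] by linarith
  qed
  obtain M :: nat where "(norm R * B)\<^sup>2 < real M" using reals_Archimedean2 by blast
  then have "norm R * B < sqrt (real M)" by (rule real_less_rsqrt)
  then show False using le[of M] by simp
qed

end

theorem theorem5:
  fixes p :: "int \<times> int" and \<Gamma> :: complex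
  assumes "p \<noteq> 0" and "\<Gamma> \<noteq> 0"
  shows "(\<exists>T. generates_group (euler_dom p \<Gamma>) (euler_op p \<Gamma>) T) \<and>
    (\<forall>T. generates_group (euler_dom p \<Gamma>) (euler_op p \<Gamma>) T \<longrightarrow>
      (\<forall>t::real. t \<noteq> 0 \<longrightarrow>
        spectrum UNIV (T t)
          = (\<lambda>z. exp (of_real t * z)) ` spectrum (euler_dom p \<Gamma>) (euler_op p \<Gamma>)))"
proof -
  interpret euler p \<Gamma> by standard (fact assms)+
  show ?thesis using U_generates spectral_mapping imaginary_axis by blast
qed

end
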